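(* Let $F\ne Z^n$ be a prepared WT equation of an embedded algebroid surface of multiplicity $n>1$, let $R_1$ be the $x$-coordinate of the rightmost vertex of $\Delta(F)$ and $L_2$ the $y$-coordinate of the leftmost vertex of $\Delta(F)$. Then, following the algorithm described in the context (with arbitrary choice of directions), the multiplicity drops in at most $n(R_1+L_2-1)+1$ transformations.
   Context: $K$ is an algebraically closed field of characteristic $0$ and $\nu$ is the usual order function on power series. An embedded algebroid surface of multiplicity $n>1$ is $\mathcal S=\mathrm{Spec}(K[[X,Y,Z]]/(F))$ with $\nu(F)=n$; $F$ is called an equation of $\mathcal S$; the tangent cone is the subvariety of $\mathbb P^2(K)$ defined by the initial form $\overline F$. A Weierstrass-Tchirnhausen (WT) equation is an equation $F=Z^n+\sum_{k=0}^{n-2}a_k(X,Y)Z^k$, $a_k=\sum_{i,j} a_{ijk}X^iY^j\in K[[X,Y]]$, $\nu(a_k)\ge n-k$. The $k$-level $\Gamma[k](F)$ is the Newton polyhedron of $a_k$: the convex hull of $\bigcup_{a_{ijk}\neq0}((i,j)+\mathbb Z_{\ge0}^2)$. The Hironaka polygon $\Delta(F)$ is the convex hull of $\bigcup_{a_{ijk}\ne0}\left[\left(\frac{i}{n-k},\frac{j}{n-k}\right)+\mathbb Q_{\ge0}^2\right]$ (over the monomials other than $Z^n$). Such a polygon is a quadrant if it has only one vertex; the empty set is also considered a quadrant. A WT equation is prepared if $\Gamma[k](F)$ is a quadrant for every $k=0,\dots,n-2$. A non-maximal prime ideal $\mathfrak p=(G,H)$ with $\nu(G)=\nu(H)=1$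 is a permissible curve if $F\in\mathfrak p^n$. Algorithm: if $(Z,X)$ or $(Z,Y)$ is a permissible curve, make a monoidal transformation centered in it; otherwise perform a quadratic transformation. A quadratic transformation in the direction $(a:b:c)$ (a point of the tangent cone) is given, say for $a\neq0$, by $X\mapsto X$, $Y\mapsto X(Y+b/a)$, $Z\mapsto X(Z+c/a)$, the new equation $F^{(1)}$ being the image of $F$ divided by $X^n$; in the direction $(0:1:0)$ by $X\mapsto XY$, $Y\mapsto Y$, $Z\mapsto YZ$, dividing by $Y^n$ (other directions with $b\ne0$ analogously). A monoidal transformation centered in $(Z,X)$ in the direction $(a:0:c)$, $a\ne0$, is $X\mapsto X$, $Y\mapsto Y$, $Z\mapsto X(Z+c/a)$, dividing by $X^n$; symmetrically for $(Z,Y)$. The multiplicity drops when the order of the new equation is smaller than $n$. *)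

theory Defs
  imports
    "HOL-Analysis.Polytope"
    "HOL-Library.Extended_Nat"
    "HOL-Computational_Algebra.Polynomial"
    "HOL-Computational_Algebra.Formal_Power_Series"
begin

text \<open>
  The ring \<open>K[[X,Y,Z]]\<close> is rendered as \<open>K[[Y]][[X]][[Z]]\<close>, so that the coefficient of \<open>Z^k\<close> of a
  series \<open>F\<close> is \<open>fps_nth F k\<close>, an element of \<open>K[[X,Y]]\<close>.
\<close>

type_synonym 'k ser2 = "'k fps fps"
type_synonym 'k ser3 = "'k fps fps fps"

definition coeff2 :: "'k ser2 \<Rightarrow> nat \<Rightarrow> nat \<Rightarrow> 'k" where
  "coeff2 a i j = fps_nth (fps_nth a i) j"

definition coeff3 :: "'k ser3 \<Rightarrow> nat \<Rightarrow> nat \<Rightarrow> nat \<Rightarrow> 'k" where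
  "coeff3 F i j k = coeff2 (fps_nth F k) i j"

definition const3 :: "'k::zero \<Rightarrow> 'k ser3" where
  "const3 c = fps_const (fps_const (fps_const c))"

definition varX :: "'k::comm_ring_1 ser3" where
  "varX = fps_const fps_X"

definition varY :: "'k::comm_ring_1 ser3" where
  "varY = fps_const (fps_const fps_X)"

definition varZ :: "'k::comm_ring_1 ser3" where
  "varZ = fps_X"

text \<open>The order functions; the order of the zero series is \<open>\<infinity>\<close>, the infimum of the empty set.\<close>

definition order2 :: "'k::zero ser2 \<Rightarrow> enat" where
  "order2 a = Inf {enat (i + j) | i j. coeff2 a i j \<noteq> 0}"

definition order3 :: "'k::zero ser3 \<Rightarrow> enat" where
  "order3 F = Inf {enat (i + j + k) | i j k. coeff3 F i j k \<noteq> 0}"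

text \<open>
  \<open>subst3 F A B C\<close> is \<open>F(A,B,C)\<close>, meaningful when \<open>A\<close>, \<open>B\<close>, \<open>C\<close> have no constant term: then
  \<open>A^i * B^j * C^k\<close> has order at least \<open>i + j + k\<close>, so only the finitely many monomials below
  contribute to the coefficient of \<open>X^p Y^q Z^r\<close>.
\<close>

definition subst3 :: "'k::comm_ring_1 ser3 \<Rightarrow> 'k ser3 \<Rightarrow> 'k ser3 \<Rightarrow> 'k ser3 \<Rightarrow> 'k ser3" where
  "subst3 F A B C =
     Abs_fps (\<lambda>r. Abs_fps (\<lambda>p. Abs_fps (\<lambda>q.
       \<Sum>(i, j, k) \<in> {(i, j, k). i + j + k \<le> p + q + r}.
         coeff3 F i j k * coeff3 (A ^ i * B ^ j * C ^ k) p q r)))"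

text \<open>The value at \<open>(a,b,c)\<close> of the initial form of a nonzero series.\<close>

definition initial_form_at :: "'k::comm_ring_1 ser3 \<Rightarrow> 'k \<Rightarrow> 'k \<Rightarrow> 'k \<Rightarrow> 'k" where
  "initial_form_at F a b c =
     (\<Sum>(i, j, k) \<in> {(i, j, k). enat (i + j + k) = order3 F}. coeff3 F i j k * a ^ i * b ^ j * c ^ k)"

text \<open>Points of the projective plane are given by homogeneous coordinates.\<close>

definition tangent_cone_point :: "'k::comm_ring_1 ser3 \<Rightarrow> 'k \<Rightarrow> 'k \<Rightarrow> 'k \<Rightarrow> bool" where
  "tangent_cone_point F a b c \<longleftrightarrow> (a, b, c) \<noteq> (0, 0, 0) \<and> initial_form_at F a b c = 0"

definition WT_equation :: "nat \<Rightarrow> 'k::comm_ring_1 ser3 \<Rightarrow> bool" where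
  "WT_equation n F \<longleftrightarrow>
     F = varZ ^ n + (\<Sum>k = 0..n-2. fps_const (fps_nth F k) * varZ ^ k) \<and>
     (\<forall>k \<in> {0..n-2}. enat (n - k) \<le> order2 (fps_nth F k))"

definition level_polyhedron :: "nat \<Rightarrow> 'k::zero ser3 \<Rightarrow> (real \<times> real) set" where
  "level_polyhedron k F =
     convex hull {(real (i + u), real (j + v)) | i j u v. coeff3 F i j k \<noteq> 0}"

definition hironaka_polygon :: "nat \<Rightarrow> 'k::zero ser3 \<Rightarrow> (real \<times> real) set" where
  "hironaka_polygon n F =
     convex hull {(real i / real (n - k) + u, real j / real (n - k) + v) | i j k u v.
       k \<in> {0..n-2} \<and> coeff3 F i j k \<noteq> 0 \<and> u \<in> \<rat> \<and> 0 \<le> u \<and> v \<in> \<rat> \<and> 0 \<le> v}"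

definition is_quadrant :: "(real \<times> real) set \<Rightarrow> bool" where
  "is_quadrant P \<longleftrightarrow> P = {} \<or> (\<exists>!v. v extreme_point_of P)"

definition rightmost_vertex :: "(real \<times> real) set \<Rightarrow> real \<times> real \<Rightarrow> bool" where
  "rightmost_vertex P v \<longleftrightarrow> v extreme_point_of P \<and> (\<forall>w. w extreme_point_of P \<longrightarrow> fst w \<le> fst v)"

definition leftmost_vertex :: "(real \<times> real) set \<Rightarrow> real \<times> real \<Rightarrow> bool" where
  "leftmost_vertex P v \<longleftrightarrow> v extreme_point_of P \<and> (\<forall>w. w extreme_point_of P \<longrightarrow> fst v \<le> fst w)"

definition prepared :: "nat \<Rightarrow> 'k::comm_ring_1 ser3 \<Rightarrow> bool" where
  "prepared n F \<longleftrightarrow> WT_equation n F \<and> (\<forall>k \<in> {0..n-2}. is_quadrant (level_polyhedron k F))"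

text \<open>Ideals of a commutative ring are its submodules; \<open>ideal_span\<close> is the generated ideal.\<close>

abbreviation is_ideal :: "'a::comm_ring_1 set \<Rightarrow> bool" where
  "is_ideal \<equiv> module.subspace (*)"

abbreviation ideal_span :: "'a::comm_ring_1 set \<Rightarrow> 'a set" where
  "ideal_span \<equiv> module.span (*)"

primrec ideal_pow :: "'a::comm_ring_1 set \<Rightarrow> nat \<Rightarrow> 'a set" where
  "ideal_pow I 0 = UNIV"
| "ideal_pow I (Suc m) = ideal_span {f * g | f g. f \<in> I \<and> g \<in> ideal_pow I m}"

definition prime_ideal :: "'a::comm_ring_1 set \<Rightarrow> bool" where
  "prime_ideal I \<longleftrightarrow> is_ideal I \<and> I \<noteq> UNIV \<and> (\<forall>f g. f * g \<in> I \<longrightarrow> f \<in> I \<or> g \<in> I)"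

definition maximal_ideal :: "'a::comm_ring_1 set \<Rightarrow> bool" where
  "maximal_ideal I \<longleftrightarrow>
     is_ideal I \<and> I \<noteq> UNIV \<and> (\<forall>J. is_ideal J \<and> I \<subseteq> J \<longrightarrow> J = I \<or> J = UNIV)"

text \<open>\<open>permissible_curve n F G H\<close>: the ideal \<open>(G,H)\<close> is a permissible curve of \<open>F\<close>.\<close>

definition permissible_curve :: "nat \<Rightarrow> 'k::comm_ring_1 ser3 \<Rightarrow> 'k ser3 \<Rightarrow> 'k ser3 \<Rightarrow> bool" where
  "permissible_curve n F G H \<longleftrightarrow>
     prime_ideal (ideal_span {G, H}) \<and> \<not> maximal_ideal (ideal_span {G, H}) \<and>
     order3 G = 1 \<and> order3 H = 1 \<and> F \<in> ideal_pow (ideal_span {G, H}) n"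

text \<open>
  In each transformation \<open>G\<close> is the new equation; the quotient by the \<open>n\<close>-th power of the
  exceptional variable is expressed by cancelling, as \<open>K[[X,Y,Z]]\<close> is a domain.
  Directions with \<open>a = b = 0\<close> have no chart, since \<open>(0:0:1)\<close> never lies on the tangent cone of a
  WT equation.
\<close>

definition quadratic_transform :: "nat \<Rightarrow> 'k::field ser3 \<Rightarrow> 'k ser3 \<Rightarrow> bool" where
  "quadratic_transform n F G \<longleftrightarrow> (\<exists>a b c. tangent_cone_point F a b c \<and>
     (a \<noteq> 0 \<and> varX ^ n * G =
        subst3 F varX (varX * (varY + const3 (b / a))) (varX * (varZ + const3 (c / a))) \<or>
      b \<noteq> 0 \<and> varY ^ n * G =
        subst3 F (varY * (varX + const3 (a / b))) varY (varY * (varZ + const3 (c / b)))))"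

definition monoidal_transform_ZX :: "nat \<Rightarrow> 'k::field ser3 \<Rightarrow> 'k ser3 \<Rightarrow> bool" where
  "monoidal_transform_ZX n F G \<longleftrightarrow> (\<exists>a c. a \<noteq> 0 \<and> tangent_cone_point F a 0 c \<and>
     varX ^ n * G = subst3 F varX varY (varX * (varZ + const3 (c / a))))"

definition monoidal_transform_ZY :: "nat \<Rightarrow> 'k::field ser3 \<Rightarrow> 'k ser3 \<Rightarrow> bool" where
  "monoidal_transform_ZY n F G \<longleftrightarrow> (\<exists>b c. b \<noteq> 0 \<and> tangent_cone_point F 0 b c \<and>
     varY ^ n * G = subst3 F varX varY (varY * (varZ + const3 (c / b))))"

text \<open>One step of the algorithm; if both curves are permissible, either one may be the centre.\<close>

definition algorithm_step :: "nat \<Rightarrow> 'k::field ser3 \<Rightarrow> 'k ser3 \<Rightarrow> bool" where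
  "algorithm_step n F G \<longleftrightarrow>
     (if permissible_curve n F varZ varX \<or> permissible_curve n F varZ varY
      then permissible_curve n F varZ varX \<and> monoidal_transform_ZX n F G \<or>
           permissible_curve n F varZ varY \<and> monoidal_transform_ZY n F G
      else quadratic_transform n F G)"

text \<open>
  \<open>drops_within n m F\<close>: whatever choices are made when running the algorithm from \<open>F\<close>, an equation
  of order less than \<open>n\<close> is reached after at most \<open>m\<close> transformations. The existence of a step is
  demanded so that a run that gets stuck does not count as a drop.
\<close>

primrec drops_within :: "nat \<Rightarrow> nat \<Rightarrow> 'k::field ser3 \<Rightarrow> bool" where
  "drops_within n 0 F \<longleftrightarrow> order3 F < enat n"
| "drops_within n (Suc m) F \<longleftrightarrow> order3 F < enat n \<or>
     (\<exists>G. algorithm_step n F G) \<and> (\<forall>G. algorithm_step n F G \<longrightarrow> drops_within n m G)"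

end

theory Submission
  imports Defs
begin

text \<open>
  Write \<open>F = Z^n + \<Sum> a\<^sub>k Z^k\<close> with \<open>k \<le> n - 2\<close>. That the levels are quadrants means that every nonzero
  \<open>a\<^sub>k\<close> is a monomial \<open>X^\<alpha> Y^\<beta>\<close> times a unit, so the Hironaka polygon is spanned by the finitely many
  points \<open>(p, q) = (\<alpha> / (n - k), \<beta> / (n - k))\<close>. The multiplicity is \<open>n\<close> as long as \<open>p + q \<ge> 1\<close> for all
  of them, and \<open>(Z,X)\<close> is permissible exactly when \<open>p \<ge> 1\<close> for all of them (\<open>permissible_ZX_iff\<close>,
  \<open>ZX_order_ge_levels\<close>).

  A direction with nonzero \<open>Z\<close>-coordinate lowers the multiplicity immediately, because the missing
  term in \<open>Z^(n-1)\<close> reappears with a unit coefficient (\<open>X_chart_drop\<close>). In every other direction the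
  coefficients remain monomials times units (\<open>X_chart_levels\<close>), so the process becomes a game on the
  points. Up to exchanging the coordinates, a monoidal transformation sends \<open>(p, q)\<close> to
  \<open>(p - 1, q)\<close>, and a quadratic one to \<open>(p + q - 1, q)\<close> or \<open>(p + q - 1, 0)\<close>.

  The potential is \<open>R\<^sub>1 + L\<^sub>2\<close>. Translations lower it by 1. Under a shear the rightmost vertex moves
  left by \<open>1 - R\<^sub>2\<close> while the leftmost vertex does not rise (\<open>potential_shear\<close>); as the curve \<open>(Z,Y)\<close>
  was not permissible, \<open>R\<^sub>2\<close> is a fraction less than 1 with denominator at most \<open>n\<close>, so the potential
  falls by at least \<open>1 / n\<close> (\<open>X_chart_progress\<close>). Since \<open>p + q \<ge> 1\<close> forces \<open>R\<^sub>1 + L\<^sub>2 \<ge> 1\<close>, at most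
  \<open>n(R\<^sub>1 + L\<^sub>2 - 1)\<close> transformations can preserve the multiplicity, and one more makes it drop
  (\<open>drops_within_potential\<close>).
\<close>

section \<open>Coefficients and orders of power series\<close>

lemma coeff3_simps [simp]:
  "coeff3 (0::'k::comm_ring_1 ser3) i j k = 0"
  "coeff3 (F + G) i j k = coeff3 F i j k + coeff3 (G::'k ser3) i j k"
  "coeff3 (1::'k ser3) i j k = (if i = 0 \<and> j = 0 \<and> k = 0 then 1 else 0)"
  "coeff3 (varX::'k ser3) i j k = (if i = 1 \<and> j = 0 \<and> k = 0 then 1 else 0)"
  "coeff3 (varY::'k ser3) i j k = (if i = 0 \<and> j = 1 \<and> k = 0 then 1 else 0)"
  "coeff3 (varZ::'k ser3) i j k = (if i = 0 \<and> j = 0 \<and> k = 1 then 1 else 0)"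
  "coeff3 (const3 c) i j k = (if i = 0 \<and> j = 0 \<and> k = 0 then c::'k else 0)"
  by (auto simp: coeff3_def coeff2_def varX_def varY_def varZ_def const3_def)

lemma coeff3_eqI: "(\<And>i j k. coeff3 F i j k = coeff3 G i j k) \<Longrightarrow> F = G"
  by (intro fps_ext) (simp add: coeff3_def coeff2_def)

lemma coeff3_mult:
  "coeff3 (F * G) i j k =
     (\<Sum>k'=0..k. \<Sum>i'=0..i. \<Sum>j'=0..j. coeff3 F i' j' k' * coeff3 G (i - i') (j - j') (k - k'))"
  by (simp add: coeff3_def coeff2_def fps_mult_nth fps_sum_nth)

text \<open>
  The pullback of a monomial under any of the chart maps has this shape, so that the
  coefficients of every transform are explicit finite sums.
\<close>

lemma coeff3_monomial:
  fixes b c :: "'k::comm_ring_1"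
  shows "coeff3 (varX ^ m * (varY + const3 b) ^ j * (varZ + const3 c) ^ k) p q r =
    (if p = m then of_nat (j choose q) * b ^ (j - q) * (of_nat (k choose r) * c ^ (k - r)) else 0)"
proof -
  have binom: "fps_nth ((fps_X + fps_const d) ^ l) s = of_nat (l choose s) * d ^ (l - s)"
    for d :: "'a::comm_ring_1" and l s
  proof -
    have "fps_nth ((fps_X + fps_const d) ^ l) s =
        (\<Sum>t\<le>l. if s = t then of_nat (l choose t) * d ^ (l - t) else 0)"
      unfolding binomial_ring fps_sum_nth
      by (intro sum.cong refl)
         (auto simp: fps_of_nat [symmetric] fps_const_power mult.assoc fps_X_power_mult_nth)
    also have "\<dots> = of_nat (l choose s) * d ^ (l - s)"
      by (simp add: sum.delta' not_le binomial_eq_0)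
    finally show ?thesis .
  qed
  have X: "varX ^ m = fps_const (fps_X ^ m :: 'k fps fps)"
    by (simp add: varX_def fps_const_power)
  have Y: "(varY + const3 b) ^ j = fps_const (fps_const ((fps_X + fps_const b) ^ j))"
    by (simp add: varY_def const3_def fps_const_power)
  have Z: "(varZ + const3 c) ^ k = (fps_X + fps_const (fps_const (fps_const c))) ^ k"
    by (simp add: varZ_def const3_def)
  have "fps_nth ((varZ + const3 c) ^ k) r =
      fps_const (fps_const (of_nat (k choose r) * c ^ (k - r)))"
    by (simp add: Z binom fps_of_nat [symmetric])
  then show ?thesis
    by (simp add: coeff3_def coeff2_def X Y binom fps_X_power_nth mult.assoc [symmetric]) 
qed

lemma coeff3_varX_power_mult:
  "coeff3 (varX ^ n * G) p q r = (if p < n then 0 else coeff3 G (p - n) q r)"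
  by (simp add: coeff3_def coeff2_def varX_def fps_const_power fps_X_power_mult_nth)

lemma order3_less_iff: "order3 F < enat n \<longleftrightarrow> (\<exists>i j k. i + j + k < n \<and> coeff3 F i j k \<noteq> 0)"
proof -
  have "order3 F < enat n \<longleftrightarrow>
      (\<exists>x\<in>{enat (i + j + k) | i j k. coeff3 F i j k \<noteq> 0}. x < enat n)"
    by (simp only: order3_def Inf_less_iff)
  also have "\<dots> \<longleftrightarrow> (\<exists>i j k. i + j + k < n \<and> coeff3 F i j k \<noteq> 0)"
    by (force simp: enat_ord_simps)
  finally show ?thesis .
qed

lemma order3_eqI:
  assumes "coeff3 F i j k \<noteq> 0" "\<not> order3 F < enat (i + j + k)"
  shows "order3 F = enat (i + j + k)"
proof (rule antisym)
  show "order3 F \<le> enat (i + j + k)"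
    unfolding order3_def using assms(1) by (blast intro: Inf_lower)
qed (use assms(2) in simp)

section \<open>The automorphism exchanging X and Y\<close>

text \<open>
  Everything below is carried out in the charts where \<open>X\<close> is the exceptional variable. The
  charts with exceptional variable \<open>Y\<close> and the curve \<open>(Z,Y)\<close> are reduced to these by this ring
  automorphism.
\<close>

definition swapXY :: "'k::comm_ring_1 ser3 \<Rightarrow> 'k ser3" where
  "swapXY F = Abs_fps (\<lambda>k. Abs_fps (\<lambda>i. Abs_fps (\<lambda>j. coeff3 F j i k)))"

lemma coeff3_swapXY [simp]: "coeff3 (swapXY F) i j k = coeff3 F j i k"
  by (simp add: swapXY_def coeff3_def coeff2_def)

lemma swapXY_swapXY [simp]: "swapXY (swapXY F) = F"
  by (rule coeff3_eqI) simp

lemma swapXY_hom [simp]: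
  "swapXY 0 = 0" "swapXY 1 = 1" "swapXY (F + G) = swapXY F + swapXY G"
  "swapXY (F * G) = swapXY F * swapXY G"
  "swapXY varX = varY" "swapXY varY = varX" "swapXY varZ = varZ" "swapXY (const3 c) = const3 c"
proof -
  show "swapXY (F * G) = swapXY F * swapXY G"
  proof (rule coeff3_eqI)
    fix i j k
    have "(\<Sum>i'=0..j. \<Sum>j'=0..i. coeff3 F i' j' k' * coeff3 G (j - i') (i - j') (k - k')) =
      (\<Sum>j'=0..i. \<Sum>i'=0..j. coeff3 F i' j' k' * coeff3 G (j - i') (i - j') (k - k'))" for k'
      by (rule sum.swap)
    then show "coeff3 (swapXY (F * G)) i j k = coeff3 (swapXY F * swapXY G) i j k"
      by (simp add: coeff3_mult)
  qed
qed (auto intro!: coeff3_eqI)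

lemma swapXY_power [simp]: "swapXY (F ^ m) = swapXY F ^ m"
  by (induction m) auto

lemma swapXY_eq_iff: "swapXY F = swapXY G \<longleftrightarrow> F = G"
  by (metis swapXY_swapXY)

lemma order3_swapXY [simp]: "order3 (swapXY F) = order3 F"
proof -
  have "{enat (i + j + k) | i j k. coeff3 (swapXY F) i j k \<noteq> 0} =
        {enat (i + j + k) | i j k. coeff3 F i j k \<noteq> 0}"
    by (auto; metis add.commute)
  then show ?thesis by (simp add: order3_def)
qed

lemma swapXY_subst3:
  "swapXY (subst3 F A B C) = subst3 (swapXY F) (swapXY B) (swapXY A) (swapXY C)"
proof (rule coeff3_eqI)
  fix p q r
  let ?S = "\<lambda>N. {(i, j, k). i + j + k \<le> (N::nat)}"
  have "coeff3 (A ^ i * B ^ j * C ^ k) q p r =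
      coeff3 (swapXY B ^ j * swapXY A ^ i * swapXY C ^ k) p q r" for i j k
  proof -
    have "swapXY B ^ j * swapXY A ^ i * swapXY C ^ k = swapXY (A ^ i * B ^ j * C ^ k)"
      by (simp add: mult.commute)
    then show ?thesis by (simp only: coeff3_swapXY)
  qed
  then have "(\<Sum>(i, j, k)\<in>?S (q + p + r). coeff3 F i j k * coeff3 (A ^ i * B ^ j * C ^ k) q p r) =
    (\<Sum>(i, j, k)\<in>?S (p + q + r). coeff3 F j i k *
       coeff3 (swapXY B ^ i * swapXY A ^ j * swapXY C ^ k) p q r)"
    by (intro sum.reindex_bij_witness
          [where i = "\<lambda>(i, j, k). (j, i, k)" and j = "\<lambda>(i, j, k). (j, i, k)"])
       (auto simp: add_ac)
  then show "coeff3 (swapXY (subst3 F A B C)) p q r =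
     coeff3 (subst3 (swapXY F) (swapXY B) (swapXY A) (swapXY C)) p q r"
    by (subst coeff3_swapXY) (simp add: subst3_def coeff3_def [of "Abs_fps _"] coeff2_def)
qed

lemma tangent_cone_point_swapXY:
  "tangent_cone_point (swapXY F) a b c \<longleftrightarrow> tangent_cone_point F b a c"
proof -
  have "initial_form_at (swapXY F) a b c = initial_form_at F b a c"
    unfolding initial_form_at_def order3_swapXY
    by (intro sum.reindex_bij_witness
          [where i = "\<lambda>(i, j, k). (j, i, k)" and j = "\<lambda>(i, j, k). (j, i, k)"])
       (auto simp: add_ac mult_ac)
  then show ?thesis by (auto simp: tangent_cone_point_def)
qed

lemma monoidal_transform_ZY_iff:
  "monoidal_transform_ZY n F G \<longleftrightarrow> monoidal_transform_ZX n (swapXY F) (swapXY G)"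
proof -
  have "varY ^ n * G = subst3 F varX varY (varY * (varZ + const3 d)) \<longleftrightarrow>
    varX ^ n * swapXY G = subst3 (swapXY F) varX varY (varX * (varZ + const3 d))" for d
    using swapXY_eq_iff [of "varY ^ n * G" "subst3 F varX varY (varY * (varZ + const3 d))"]
    by (simp add: swapXY_subst3)
  then show ?thesis
    by (auto simp: monoidal_transform_ZY_def monoidal_transform_ZX_def tangent_cone_point_swapXY)
qed

section \<open>Permissible coordinate axes and the order along them\<close>

interpretation ideal: module "(*) :: 'a::comm_ring_1 \<Rightarrow> 'a \<Rightarrow> 'a"
  by unfold_locales (simp_all add: algebra_simps)

text \<open>
  The order along the axis \<open>Z = X = 0\<close> is at least \<open>m\<close>.
\<close>

definition ZX_order_ge :: "nat \<Rightarrow> 'k::comm_ring_1 ser3 \<Rightarrow> bool" where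
  "ZX_order_ge m F \<longleftrightarrow> (\<forall>i j k. i + k < m \<longrightarrow> coeff3 F i j k = 0)"

lemma ZX_order_ge_mult:
  assumes "ZX_order_ge a F" "ZX_order_ge b G"
  shows "ZX_order_ge (a + b) (F * G)"
  unfolding ZX_order_ge_def
proof (intro allI impI)
  fix i j k assume "i + k < a + b"
  then have "coeff3 F i' j' k' * coeff3 G (i - i') (j - j') (k - k') = 0"
    if "i' \<le> i" "k' \<le> k" for i' j' k'
  proof (cases "i' + k' < a")
    case False
    with that \<open>i + k < a + b\<close> have "i - i' + (k - k') < b" by linarith
    then show ?thesis using assms by (simp add: ZX_order_ge_def)
  qed (use assms in \<open>simp add: ZX_order_ge_def\<close>)
  then show "coeff3 (F * G) i j k = 0" by (simp add: coeff3_mult)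
qed

lemma is_ideal_ZX_order_ge: "is_ideal {F. ZX_order_ge m F}"
proof (rule ideal.subspaceI)
  show "c * F \<in> {F. ZX_order_ge m F}" if "F \<in> {F. ZX_order_ge m F}" for c F
    using that ZX_order_ge_mult [of 0 c m F] by (simp add: ZX_order_ge_def)
qed (simp_all add: ZX_order_ge_def)

lemma ZX_decomposition:
  assumes "ZX_order_ge (Suc m) F"
  obtains A B where "F = varX * A + varZ * B" "ZX_order_ge m A" "ZX_order_ge m B"
proof
  let ?A = "fps_const (fps_shift 1 (fps_nth F 0))" and ?B = "fps_shift 1 F"
  have "fps_nth (fps_nth F 0) 0 = 0"
    using assms by (intro fps_ext) (simp add: ZX_order_ge_def coeff3_def coeff2_def)
  then show "F = varX * ?A + varZ * ?B"
    by (intro fps_ext) (auto simp: varX_def varZ_def)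
  show "ZX_order_ge m ?A" "ZX_order_ge m ?B"
    using assms by (auto simp: ZX_order_ge_def coeff3_def coeff2_def)
qed

lemma ideal_span_ZX: "ideal_span {varZ, varX} = {F. ZX_order_ge 1 (F::'k::comm_ring_1 ser3)}"
proof
  show "ideal_span {varZ, varX} \<subseteq> {F. ZX_order_ge 1 (F::'k ser3)}"
    by (rule ideal.span_minimal [OF _ is_ideal_ZX_order_ge]) (auto simp: ZX_order_ge_def)
  show "{F. ZX_order_ge 1 F} \<subseteq> ideal_span {varZ, varX::'k ser3}"
  proof
    fix F :: "'k ser3" assume "F \<in> {F. ZX_order_ge 1 F}"
    then have "ZX_order_ge (Suc 0) F" by simp
    then obtain A B where "F = varX * A + varZ * B" "ZX_order_ge 0 A" "ZX_order_ge 0 B"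
      by (rule ZX_decomposition)
    then have "F = A * varX + B * varZ" by (simp add: mult.commute)
    then show "F \<in> ideal_span {varZ, varX}"
      by (metis ideal.span_add ideal.span_scale ideal.span_base insertI1 insertI2)
  qed
qed

text \<open>
  The \<open>m\<close>-th power of \<open>(Z,X)\<close> can be read off from the exponents: a series of order at least
  \<open>m + 1\<close> along the axis is \<open>X A + Z B\<close> with \<open>A\<close> and \<open>B\<close> of order at least \<open>m\<close>, which gives the
  non-trivial inclusion by induction on \<open>m\<close>.
\<close>

lemma ideal_pow_ZX:
  "ideal_pow (ideal_span {varZ, varX}) m = {F. ZX_order_ge m (F::'k::comm_ring_1 ser3)}"
proof (induction m)
  case 0
  then show ?case by (simp add: ZX_order_ge_def)
next
  case (Suc m)
  let ?P = "{f * g | f g::'k ser3. f \<in> ideal_span {varZ, varX} \<and> ZX_order_ge m g}"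
  have "ideal_span ?P \<subseteq> {F. ZX_order_ge (Suc m) F}"
    using ZX_order_ge_mult [of 1 _ m]
    by (intro ideal.span_minimal is_ideal_ZX_order_ge) (auto simp: ideal_span_ZX)
  moreover have "F \<in> ideal_span ?P" if F: "ZX_order_ge (Suc m) F" for F
  proof -
    obtain A B where "F = varX * A + varZ * B" "ZX_order_ge m A" "ZX_order_ge m B"
      using ZX_decomposition [OF F] .
    moreover have "varX \<in> ideal_span {varZ, varX::'k ser3}" "varZ \<in> ideal_span {varZ, varX::'k ser3}"
      by (auto intro: ideal.span_base)
    ultimately have "varX * A \<in> ?P" "varZ * B \<in> ?P" by blast+
    with \<open>F = varX * A + varZ * B\<close> show ?thesis
      by (simp only: ideal.span_add ideal.span_base)
  qed
  ultimately show ?case using Suc.IH by auto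
qed

text \<open>
  The requirements on the ideal itself always hold: \<open>(Z,X)\<close> is the kernel of the restriction
  \<open>F \<mapsto> F(0,Y,0)\<close> to the domain \<open>K[[Y]]\<close>, hence prime, and it is properly contained in the ideal of
  the series without constant term. Only the order along the axis remains.
\<close>

lemma permissible_ZX_iff:
  fixes F :: "'k::field ser3"
  shows "permissible_curve n F varZ varX \<longleftrightarrow> ZX_order_ge n F"
proof -
  let ?I = "{F::'k ser3. ZX_order_ge 1 F}" and ?M = "{F::'k ser3. coeff3 F 0 0 0 = 0}"
  have I: "F \<in> ?I \<longleftrightarrow> fps_nth (fps_nth F 0) 0 = 0" for F
    by (auto simp: ZX_order_ge_def coeff3_def coeff2_def fps_eq_iff)
  have "prime_ideal ?I"
    unfolding prime_ideal_def
  proof (intro conjI allI impI)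
    show "?I \<noteq> UNIV" using I [of 1] by auto
    show "f \<in> ?I \<or> g \<in> ?I" if "f * g \<in> ?I" for f g
      using that unfolding I by simp
  qed (rule is_ideal_ZX_order_ge)
  moreover have "\<not> maximal_ideal ?I"
  proof
    assume max: "maximal_ideal ?I"
    have "is_ideal ?M" by (rule ideal.subspaceI) (auto simp: coeff3_mult)
    moreover have "?I \<subseteq> ?M" by (simp add: ZX_order_ge_def subset_iff)
    moreover have "varY \<in> ?M" "varY \<notin> ?I" by (simp_all add: ZX_order_ge_def)
    then have "?M \<noteq> ?I" by metis
    moreover have "1 \<notin> ?M" by simp
    then have "?M \<noteq> UNIV" by (metis UNIV_I)
    ultimately show False using max unfolding maximal_ideal_def by metis
  qed
  moreover have "order3 (varZ::'k ser3) = 1" "order3 (varX::'k ser3) = 1"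
    using order3_eqI [of "varZ::'k ser3" 0 0 1] order3_eqI [of "varX::'k ser3" 1 0 0]
    by (auto simp: order3_less_iff one_enat_def)
  ultimately show ?thesis
    unfolding permissible_curve_def ideal_pow_ZX by (simp add: ideal_span_ZX)
qed

lemma vimage_swapXY [simp]: "swapXY -` (swapXY -` S) = S"
  by auto

lemma vimage_swapXY_eqD: "swapXY -` S = T \<Longrightarrow> S = swapXY -` T"
  by (drule sym) simp

lemma is_ideal_vimage_swapXY: "is_ideal I \<Longrightarrow> is_ideal (swapXY -` I)"
  unfolding ideal.subspace_def by simp

lemma ideal_span_vimage_swapXY: "ideal_span (swapXY -` S) = swapXY -` ideal_span S"
proof -
  have *: "ideal_span (swapXY -` S) \<subseteq> swapXY -` ideal_span S" for S :: "'a ser3 set"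
    by (intro ideal.span_minimal is_ideal_vimage_swapXY ideal.subspace_span)
       (auto intro: ideal.span_base)
  have "swapXY -` ideal_span S \<subseteq> swapXY -` (swapXY -` ideal_span (swapXY -` S))"
    by (rule vimage_mono) (use * [of "swapXY -` S"] in \<open>simp only: vimage_swapXY\<close>)
  then have "swapXY -` ideal_span S \<subseteq> ideal_span (swapXY -` S)"
    by (simp only: vimage_swapXY)
  with * [of S] show ?thesis by (rule equalityI)
qed

lemma ideal_pow_vimage_swapXY: "ideal_pow (swapXY -` I) m = swapXY -` ideal_pow I m"
proof (induction m)
  case (Suc m)
  have "{f * g | f g. f \<in> swapXY -` I \<and> g \<in> swapXY -` ideal_pow I m} =
    swapXY -` {f * g | f g. f \<in> I \<and> g \<in> ideal_pow I m}"
    (is "?L = ?R")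
  proof
    show "?L \<subseteq> ?R"
    proof
      fix x assume "x \<in> ?L"
      then obtain f g where "x = f * g" "swapXY f \<in> I" "swapXY g \<in> ideal_pow I m" by auto
      then have "swapXY x = swapXY f * swapXY g" by simp
      with \<open>swapXY f \<in> I\<close> \<open>swapXY g \<in> ideal_pow I m\<close> show "x \<in> ?R" by blast
    qed
    show "?R \<subseteq> ?L"
    proof
      fix x assume "x \<in> ?R"
      then obtain f g where "swapXY x = f * g" "f \<in> I" "g \<in> ideal_pow I m" by auto
      then have "swapXY f \<in> swapXY -` I" "swapXY g \<in> swapXY -` ideal_pow I m" by simp_all
      moreover have "x = swapXY f * swapXY g"
        using arg_cong [OF \<open>swapXY x = f * g\<close>, of swapXY] by simp
      ultimately show "x \<in> ?L" by blast
    qed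
  qed
  with Suc.IH show ?case by (simp only: ideal_pow.simps ideal_span_vimage_swapXY)
qed simp

lemma prime_ideal_vimage_swapXY:
  assumes "prime_ideal I"
  shows "prime_ideal (swapXY -` I)"
  unfolding prime_ideal_def
proof (intro conjI allI impI)
  show "is_ideal (swapXY -` I)"
    using assms by (intro is_ideal_vimage_swapXY) (simp add: prime_ideal_def)
  show "swapXY -` I \<noteq> UNIV"
    using assms vimage_swapXY_eqD [of I UNIV] by (auto simp: prime_ideal_def)
  show "f \<in> swapXY -` I \<or> g \<in> swapXY -` I" if "f * g \<in> swapXY -` I" for f g
    using assms that by (simp add: prime_ideal_def)
qed

lemma maximal_ideal_vimage_swapXY:
  assumes "maximal_ideal I"
  shows "maximal_ideal (swapXY -` I)"
  unfolding maximal_ideal_def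
proof (intro conjI allI impI; (elim conjE)?)
  show "is_ideal (swapXY -` I)"
    using assms by (intro is_ideal_vimage_swapXY) (simp add: maximal_ideal_def)
  show "swapXY -` I \<noteq> UNIV"
    using assms vimage_swapXY_eqD [of I UNIV] by (auto simp: maximal_ideal_def)
next
  fix J assume J: "is_ideal J" "swapXY -` I \<subseteq> J"
  have "I \<subseteq> swapXY -` J"
    using vimage_mono [OF J(2), of swapXY] by simp
  then have "swapXY -` J = I \<or> swapXY -` J = UNIV"
    using assms is_ideal_vimage_swapXY [OF J(1)] by (simp add: maximal_ideal_def)
  then show "J = swapXY -` I \<or> J = UNIV"
    using vimage_swapXY_eqD [of J I] vimage_swapXY_eqD [of J UNIV] by auto
qed

text \<open>
  All ideal-theoretic notions are invariant under the exchange of \<open>X\<close> and \<open>Y\<close>, which carries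
  \<open>(Z,Y)\<close> to \<open>(Z,X)\<close>.
\<close>

lemma permissible_ZY_iff:
  fixes F :: "'k::field ser3"
  shows "permissible_curve n F varZ varY \<longleftrightarrow> ZX_order_ge n (swapXY F)"
proof -
  have "{varZ, varY} = swapXY -` {varZ, varX :: 'k ser3}"
    using swapXY_eq_iff [of _ varY] swapXY_eq_iff [of _ varZ] by auto
  then have span: "ideal_span {varZ, varY} = swapXY -` ideal_span {varZ, varX :: 'k ser3}"
    by (simp add: ideal_span_vimage_swapXY)
  have "prime_ideal (swapXY -` I) \<longleftrightarrow> prime_ideal I"
       "maximal_ideal (swapXY -` I) \<longleftrightarrow> maximal_ideal I" for I :: "'k ser3 set"
    using prime_ideal_vimage_swapXY [of I] prime_ideal_vimage_swapXY [of "swapXY -` I"]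
      maximal_ideal_vimage_swapXY [of I] maximal_ideal_vimage_swapXY [of "swapXY -` I"]
    by auto
  moreover have "order3 (varY :: 'k ser3) = order3 (varX :: 'k ser3)"
    using order3_swapXY [of "varX :: 'k ser3"] by simp
  ultimately have "permissible_curve n F varZ varY \<longleftrightarrow> permissible_curve n (swapXY F) varZ varX"
    by (simp add: permissible_curve_def span ideal_pow_vimage_swapXY)
  then show ?thesis by (simp add: permissible_ZX_iff)
qed

section \<open>Lexicographic corners of a finite planar configuration\<close>

text \<open>
  For a configuration of points \<open>(p k, q k)\<close>, \<open>k \<in> D\<close>, the number \<open>corner D p q\<close> is the abscissa of
  the rightmost vertex of the polygon that they span with the quadrant: the vertex is the leftmost
  one among the lowest points. With the coordinates exchanged, \<open>corner D q p\<close> is the ordinate of the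
  leftmost vertex. The \<open>potential\<close> is thus \<open>R\<^sub>1 + L\<^sub>2\<close>.
\<close>

definition corner :: "nat set \<Rightarrow> (nat \<Rightarrow> real) \<Rightarrow> (nat \<Rightarrow> real) \<Rightarrow> real" where
  "corner D p q = Min (p ` {k \<in> D. \<forall>l\<in>D. q k \<le> q l})"

definition potential :: "nat set \<Rightarrow> (nat \<Rightarrow> real) \<Rightarrow> (nat \<Rightarrow> real) \<Rightarrow> real" where
  "potential D p q = corner D p q + corner D q p"

lemma corner_attained:
  assumes "finite D" "D \<noteq> {}"
  obtains k where "k \<in> D" "corner D p q = p k" "\<And>l. l \<in> D \<Longrightarrow> q k \<le> q l"
    "\<And>l. l \<in> D \<Longrightarrow> q l = q k \<Longrightarrow> p k \<le> p l"
proof -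
  let ?E = "{k \<in> D. \<forall>l\<in>D. q k \<le> q l}"
  have "Min (q ` D) \<in> q ` D" using assms by (intro Min_in) auto
  then obtain m where "m \<in> D" "Min (q ` D) = q m" by (rule imageE)
  then have "m \<in> ?E"
    using assms(1) Min_le [of "q ` D"] by force
  then have ne: "?E \<noteq> {}" by blast
  then have "corner D p q \<in> p ` ?E"
    unfolding corner_def using assms by (intro Min_in) auto
  then obtain k where k: "k \<in> ?E" "corner D p q = p k" by auto
  have "p k \<le> p l" if "l \<in> D" "q l = q k" for l
    using that k assms unfolding k(2) [symmetric] corner_def by (intro Min_le) auto
  with k that show thesis by auto
qed

lemma corner_le:
  assumes "finite D" "k \<in> D" "\<And>l. l \<in> D \<Longrightarrow> q k \<le> q l"
  shows "corner D p q \<le> p k"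
  unfolding corner_def using assms by (intro Min_le) auto

lemma potential_commute: "potential D p q = potential D q p"
  by (simp add: potential_def)

text \<open>
  The rightmost vertex \<open>(R\<^sub>1, R\<^sub>2)\<close> is one of the points, and \<open>R\<^sub>2 \<le> L\<^sub>2\<close> since no point is lower.
\<close>

lemma potential_ge_1:
  assumes "finite D" "D \<noteq> {}" "\<And>k. k \<in> D \<Longrightarrow> 1 \<le> p k + q k"
  shows "1 \<le> potential D p q"
proof -
  obtain k where k: "k \<in> D" "corner D p q = p k" "\<And>l. l \<in> D \<Longrightarrow> q k \<le> q l"
    using corner_attained [OF assms(1,2), of p q] by metis
  obtain l where "l \<in> D" "corner D q p = q l"
    using corner_attained [OF assms(1,2), of q p] by metis
  with k assms(3) [of k] show ?thesis by (fastforce simp: potential_def)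
qed

text \<open>
  A monoidal transformation translates the configuration by one unit.
\<close>

lemma potential_shift:
  assumes "finite D" "D \<noteq> {}" "\<And>k. k \<in> D \<Longrightarrow> p' k = p k - 1" "\<And>k. k \<in> D \<Longrightarrow> q' k = q k"
  shows "potential D p' q' \<le> potential D p q - 1"
proof -
  obtain k where k: "k \<in> D" "corner D p q = p k" "\<And>l. l \<in> D \<Longrightarrow> q k \<le> q l"
    using corner_attained [OF assms(1,2), of p q] by metis
  obtain l where l: "l \<in> D" "corner D q p = q l" "\<And>k. k \<in> D \<Longrightarrow> p l \<le> p k"
    using corner_attained [OF assms(1,2), of q p] by metis
  have "corner D p' q' \<le> p' k" "corner D q' p' \<le> q' l"
    using k(1,3) l(1,3) assms(3,4) by (intro corner_le assms(1); simp)+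
  with k l assms show ?thesis by (simp add: potential_def)
qed

text \<open>
  A quadratic transformation shears the configuration, and in addition flattens it onto the
  \<open>x\<close>-axis in a general direction. The rightmost vertex \<open>(R\<^sub>1, R\<^sub>2)\<close> moves left
  by \<open>1 - R\<^sub>2\<close>, which is at least \<open>d\<close> if some point has ordinate at most \<open>1 - d\<close>. The leftmost vertex
  does not rise: the new leftmost point has \<open>p + q \<le> L\<^sub>1 + L\<^sub>2\<close> and \<open>p \<ge> L\<^sub>1\<close>, hence \<open>q \<le> L\<^sub>2\<close>.
\<close>

lemma potential_shear:
  assumes "finite D" "D \<noteq> {}" "\<And>k. k \<in> D \<Longrightarrow> p' k = p k + q k - 1"
    "(\<forall>k\<in>D. q' k = q k) \<or> (\<forall>k\<in>D. q' k = 0)"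
    "\<And>k. k \<in> D \<Longrightarrow> 0 \<le> q k"
    "\<exists>k\<in>D. q k \<le> 1 - d"
  shows "potential D p' q' \<le> potential D p q - d"
proof -
  obtain k where k: "k \<in> D" "corner D p q = p k" "\<And>l. l \<in> D \<Longrightarrow> q k \<le> q l"
    using corner_attained [OF assms(1,2), of p q] by metis
  obtain l where l: "l \<in> D" "corner D q p = q l" "\<And>k. k \<in> D \<Longrightarrow> p l \<le> p k"
    using corner_attained [OF assms(1,2), of q p] by metis
  obtain m where m: "m \<in> D" "corner D q' p' = q' m" "\<And>k. k \<in> D \<Longrightarrow> p' m \<le> p' k"
    using corner_attained [OF assms(1,2), of q' p'] by metis
  have "corner D p' q' \<le> p' k"
    using assms(1,4) k by (auto intro!: corner_le)
  moreover have "q k \<le> 1 - d"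
    using assms(6) k(3) by force
  moreover have "q' m \<le> q l"
    using assms(4)
  proof
    assume "\<forall>k\<in>D. q' k = q k"
    with l(3) [of m] m(3) [of l] assms(3) l(1) m(1) show ?thesis by simp
  qed (use assms(5) l(1) m(1) in simp)
  ultimately show ?thesis using k l m assms(3) by (simp add: potential_def)
qed

section \<open>Equations whose coefficients are monomials times units\<close>

text \<open>
  The form of a prepared equation that survives the transformations: the coefficient of \<open>Z^k\<close> is
  \<open>X^(\<alpha> k) Y^(\<beta> k)\<close> times a unit for the levels \<open>k \<in> D\<close>, and zero at all other levels below \<open>n\<close>.
  Bounds on the orders of these coefficients are a separate condition, namely that the
  multiplicity is still \<open>n\<close> (see \<open>levels_sum_ge\<close>).
\<close>

definition monomial_levels ::
    "nat \<Rightarrow> nat set \<Rightarrow> (nat \<Rightarrow> nat) \<Rightarrow> (nat \<Rightarrow> nat) \<Rightarrow> 'k::comm_ring_1 ser3 \<Rightarrow> bool" where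
  "monomial_levels n D \<alpha> \<beta> F \<longleftrightarrow>
     D \<noteq> {} \<and> D \<subseteq> {k. k + 2 \<le> n} \<and>
     (\<forall>i j k. coeff3 F i j k \<noteq> 0 \<longrightarrow>
        i = 0 \<and> j = 0 \<and> k = n \<or> k \<in> D \<and> \<alpha> k \<le> i \<and> \<beta> k \<le> j) \<and>
     coeff3 F 0 0 n = 1 \<and> (\<forall>k\<in>D. coeff3 F (\<alpha> k) (\<beta> k) k \<noteq> 0)"

text \<open>
  With both exponent functions scaled, the levels become the points of the Hironaka polygon.
\<close>

definition scaled :: "nat \<Rightarrow> (nat \<Rightarrow> nat) \<Rightarrow> nat \<Rightarrow> real" where
  "scaled n \<alpha> k = real (\<alpha> k) / real (n - k)"

lemma monomial_levelsD:
  assumes "monomial_levels n D \<alpha> \<beta> F"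
  shows "coeff3 F i j k \<noteq> 0 \<Longrightarrow> i = 0 \<and> j = 0 \<and> k = n \<or> k \<in> D \<and> \<alpha> k \<le> i \<and> \<beta> k \<le> j"
    and "k \<in> D \<Longrightarrow> k + 2 \<le> n" and "coeff3 F 0 0 n = 1"
    and "k \<in> D \<Longrightarrow> coeff3 F (\<alpha> k) (\<beta> k) k \<noteq> 0" and "D \<noteq> {}"
  using assms by (auto simp: monomial_levels_def)

lemma monomial_levels_swapXY:
  assumes "monomial_levels n D \<alpha> \<beta> F"
  shows "monomial_levels n D \<beta> \<alpha> (swapXY F)"
  unfolding monomial_levels_def coeff3_swapXY
proof (intro conjI allI impI ballI subsetI)
  show "i = 0 \<and> j = 0 \<and> k = n \<or> k \<in> D \<and> \<beta> k \<le> i \<and> \<alpha> k \<le> j"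
    if "coeff3 F j i k \<noteq> 0" for i j k
    using monomial_levelsD(1) [OF assms that] by auto
qed (use monomial_levelsD(2-5) [OF assms] in auto)

lemma finite_levels: "monomial_levels n D \<alpha> \<beta> F \<Longrightarrow> finite D"
  by (rule finite_subset [of _ "{..n}"]) (auto dest: monomial_levelsD(2))

lemma levels_sum_ge:
  assumes "monomial_levels n D \<alpha> \<beta> F" "\<not> order3 F < enat n" "k \<in> D"
  shows "n \<le> \<alpha> k + \<beta> k + k"
proof (rule ccontr)
  assume "\<not> n \<le> \<alpha> k + \<beta> k + k"
  then have "order3 F < enat n"
    unfolding order3_less_iff
    by (intro exI conjI) (rule not_le_imp_less, assumption, rule monomial_levelsD(4) [OF assms(1,3)])
  with assms(2) show False ..
qed

lemma order3_eq:
  assumes "monomial_levels n D \<alpha> \<beta> F" "\<not> order3 F < enat n"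
  shows "order3 F = enat n"
  using order3_eqI [of F 0 0 n] assms by (simp add: monomial_levels_def)

lemma ZX_order_ge_levels:
  assumes "monomial_levels n D \<alpha> \<beta> F"
  shows "ZX_order_ge n F \<longleftrightarrow> (\<forall>k\<in>D. n \<le> \<alpha> k + k)"
proof
  show "\<forall>k\<in>D. n \<le> \<alpha> k + k" if F: "ZX_order_ge n F"
  proof (rule ballI, rule ccontr)
    fix k assume "k \<in> D" "\<not> n \<le> \<alpha> k + k"
    then have "coeff3 F (\<alpha> k) (\<beta> k) k = 0" using F unfolding ZX_order_ge_def by (metis not_le)
    with monomial_levelsD(4) [OF assms \<open>k \<in> D\<close>] show False by simp
  qed
  show "ZX_order_ge n F" if "\<forall>k\<in>D. n \<le> \<alpha> k + k"
    unfolding ZX_order_ge_def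
  proof (intro allI impI, rule ccontr)
    fix i j k assume "i + k < n" "coeff3 F i j k \<noteq> 0"
    with monomial_levelsD(1) [OF assms, of i j k] have "k \<in> D" "\<alpha> k \<le> i" by simp_all
    with that have "n \<le> \<alpha> k + k" by blast
    with \<open>i + k < n\<close> \<open>\<alpha> k \<le> i\<close> show False by linarith
  qed
qed

section \<open>Blow-ups in the charts with exceptional variable X\<close>

text \<open>
  One family covers all cases in which \<open>X\<close> is the exceptional variable: \<open>e = 1\<close> gives the quadratic
  transformations, and \<open>e = 0\<close>, \<open>b = 0\<close> the monoidal transformations with centre \<open>(Z,X)\<close>.
\<close>

definition X_chart :: "nat \<Rightarrow> 'k::comm_ring_1 \<Rightarrow> 'k \<Rightarrow> 'k ser3 \<Rightarrow> 'k ser3" where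
  "X_chart e b c F = subst3 F varX (varX ^ e * (varY + const3 b)) (varX * (varZ + const3 c))"

text \<open>
  The coefficient of \<open>T^q\<close> in \<open>(T + b)^j\<close>.
\<close>

definition shift_coeff :: "'k::comm_ring_1 \<Rightarrow> nat \<Rightarrow> nat \<Rightarrow> 'k" where
  "shift_coeff b j q = of_nat (j choose q) * b ^ (j - q)"

lemma coeff3_X_chart:
  fixes F :: "'k::field ser3"
  shows "coeff3 (X_chart e b c F) p q r =
    (\<Sum>(i, j, k) \<in> {(i, j, k). i + j + k \<le> p + q + r}.
       coeff3 F i j k * (if p = i + e * j + k then shift_coeff b j q * shift_coeff c k r else 0))"
proof -
  have "varX ^ i * (varX ^ e * (varY + const3 b)) ^ j * (varX * (varZ + const3 c)) ^ k =
     varX ^ (i + e * j + k) * (varY + const3 b) ^ j * (varZ + const3 c) ^ k" for i j k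
    by (simp only: power_add power_mult_distrib power_mult [symmetric] ac_simps)
  then show ?thesis
    unfolding shift_coeff_def
    by (simp add: X_chart_def subst3_def coeff3_def [of "Abs_fps _"] coeff2_def coeff3_monomial)
qed

lemma finite_total_degree_le: "finite {(i, j, k). i + j + k \<le> (N::nat)}"
  by (rule finite_subset [of _ "{..N} \<times> {..N} \<times> {..N}"]) auto

lemma X_chart_nonzeroE:
  fixes F :: "'k::field ser3"
  assumes "coeff3 (X_chart e b c F) p q r \<noteq> 0"
  obtains i j k where "coeff3 F i j k \<noteq> 0" "p = i + e * j + k"
    "shift_coeff b j q \<noteq> 0" "shift_coeff c k r \<noteq> 0"
proof -
  obtain x where "(case x of (i, j, k) \<Rightarrow> coeff3 F i j k *
      (if p = i + e * j + k then shift_coeff b j q * shift_coeff c k r else 0)) \<noteq> 0"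
    using assms unfolding coeff3_X_chart by (rule sum.not_neutral_contains_not_neutral)
  then show thesis by (cases x) (auto intro: that split: if_splits)
qed

text \<open>
  A coefficient of the total transform that receives contributions from only one monomial of \<open>F\<close>
  is not affected by cancellation; this is how vertices of the levels are followed.
\<close>

lemma X_chart_single:
  fixes F :: "'k::field ser3"
  assumes "\<And>i' j' k'. coeff3 F i' j' k' \<noteq> 0 \<Longrightarrow> p = i' + e * j' + k' \<Longrightarrow>
      shift_coeff b j' q \<noteq> 0 \<Longrightarrow> shift_coeff c k' r \<noteq> 0 \<Longrightarrow> i' = i \<and> j' = j \<and> k' = k"
    and "p = i + e * j + k" "i + j + k \<le> p + q + r"
  shows "coeff3 (X_chart e b c F) p q r = coeff3 F i j k * (shift_coeff b j q * shift_coeff c k r)"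
proof -
  let ?f = "\<lambda>(i, j, k). coeff3 F i j k *
      (if p = i + e * j + k then shift_coeff b j q * shift_coeff c k r else 0)"
  have "coeff3 (X_chart e b c F) p q r = sum ?f {(i, j, k)}"
    unfolding coeff3_X_chart
  proof (rule sum.mono_neutral_right)
    show "\<forall>x\<in>{(i, j, k). i + j + k \<le> p + q + r} - {(i, j, k)}. ?f x = 0"
      using assms(1) by (auto split: if_splits)
  qed (use assms(3) finite_total_degree_le in auto)
  then show ?thesis using assms(2) by simp
qed

lemma shift_coeff_0: "shift_coeff 0 j q = (if j = q then 1 else (0::'k::comm_ring_1))"
  by (cases j q rule: linorder_cases) (auto simp: shift_coeff_def binomial_eq_0 power_0_left)

lemma shift_coeff_bottom: "shift_coeff b j 0 = b ^ j"
  by (simp add: shift_coeff_def)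

lemma shift_coeff_top: "shift_coeff b j j = 1"
  by (simp add: shift_coeff_def)

lemma shift_coeff_nonzeroD: "shift_coeff b j q \<noteq> 0 \<Longrightarrow> q \<le> j"
  by (rule ccontr) (simp add: shift_coeff_def binomial_eq_0)

text \<open>
  A direction outside the plane \<open>Z = 0\<close> makes the multiplicity drop at once: since \<open>F\<close> has no term
  in \<open>Z^(n-1)\<close>, the coefficient of \<open>Z^(n-1)\<close> in the transform has the constant term \<open>n c\<close>, which is
  nonzero in characteristic zero.
\<close>

lemma X_chart_drop:
  fixes G :: "'k::field_char_0 ser3"
  assumes F: "monomial_levels n D \<alpha> \<beta> F" and "1 < n"
    and e: "e = 1 \<or> e = 0 \<and> b = 0"
    and G: "varX ^ n * G = X_chart e b c F" and c: "c \<noteq> 0"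
  shows "order3 G < enat n"
proof -
  have "coeff3 G 0 0 (n - 1) = coeff3 (X_chart e b c F) n 0 (n - 1)"
    by (simp add: G [symmetric] coeff3_varX_power_mult)
  also have "\<dots> = coeff3 F 0 0 n * (shift_coeff b 0 0 * shift_coeff c n (n - 1))"
  proof (rule X_chart_single)
    fix i j k
    assume "coeff3 F i j k \<noteq> 0" "n = i + e * j + k" "shift_coeff c k (n - 1) \<noteq> 0"
    moreover from this have "n - 1 \<le> k" by (auto dest: shift_coeff_nonzeroD)
    ultimately show "i = 0 \<and> j = 0 \<and> k = n"
      using monomial_levelsD(1) [OF F, of i j k] monomial_levelsD(2) [OF F, of k] by fastforce
  qed auto
  also have "\<dots> = of_nat n * c"
    using F \<open>1 < n\<close> binomial_symmetric [of 1 n]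
    by (simp add: monomial_levels_def shift_coeff_def)
  finally have "coeff3 G 0 0 (n - 1) \<noteq> 0" using c \<open>1 < n\<close> by simp
  then show ?thesis using \<open>1 < n\<close> unfolding order3_less_iff
    by (intro exI [of _ 0] exI [of _ "n - 1"]) simp
qed

text \<open>
  A direction in the plane \<open>Z = 0\<close> transforms the levels independently of each other, and each
  remains a monomial times a unit: \<open>X^\<alpha> Y^\<beta>\<close> becomes \<open>X^(\<alpha> + e \<beta> - (n - k)) (Y + b)^\<beta>\<close>, and
  \<open>(Y + b)^\<beta>\<close> is itself a unit if \<open>b \<noteq> 0\<close>.
\<close>

lemma X_chart_levels:
  fixes F :: "'k::field ser3"
  assumes F: "monomial_levels n D \<alpha> \<beta> F"
    and e: "e = 1 \<or> e = 0 \<and> b = 0"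
    and ge: "\<And>k. k \<in> D \<Longrightarrow> n \<le> \<alpha> k + e * \<beta> k + k"
    and G: "varX ^ n * G = X_chart e b 0 F"
  shows "monomial_levels n D (\<lambda>k. \<alpha> k + e * \<beta> k + k - n) (if b = 0 then \<beta> else (\<lambda>k. 0)) G"
proof -
  have G': "coeff3 G p q r = coeff3 (X_chart e b 0 F) (p + n) q r" for p q r
    by (simp add: G [symmetric] coeff3_varX_power_mult)
  have single: "coeff3 G (i + e * j + k - n) q k = coeff3 F i j k * shift_coeff b j q"
    if "n \<le> i + e * j + k" "q = j \<or> b \<noteq> 0"
      and "\<And>i' j'. coeff3 F i' j' k \<noteq> 0 \<Longrightarrow> i \<le> i' \<and> j \<le> j'" for i j k q
  proof -
    have "coeff3 G (i + e * j + k - n) q k =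
        coeff3 F i j k * (shift_coeff b j q * shift_coeff 0 k k)"
      unfolding G'
    proof (rule X_chart_single)
      fix i' j' k'
      assume *: "coeff3 F i' j' k' \<noteq> 0" "i + e * j + k - n + n = i' + e * j' + k'"
        "shift_coeff b j' q \<noteq> 0" "shift_coeff (0::'k) k' k \<noteq> 0"
      then have "k' = k" by (simp add: shift_coeff_0 split: if_splits)
      with * that(3) have "i \<le> i'" "j \<le> j'" by auto
      from e show "i' = i \<and> j' = j \<and> k' = k"
      proof
        assume "e = 1"
        with \<open>i \<le> i'\<close> \<open>j \<le> j'\<close> \<open>k' = k\<close> *(2) that(1) show ?thesis by simp
      next
        assume "e = 0 \<and> b = 0"
        with *(2,3) that(1,2) \<open>k' = k\<close> show ?thesis by (simp add: shift_coeff_0 split: if_splits)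
      qed
    qed (use that(1,2) e in auto)
    then show ?thesis by (simp add: shift_coeff_0)
  qed
  have "coeff3 G 0 0 n = 1"
    using single [of 0 0 n 0] monomial_levelsD(3) [OF F] by (simp add: shift_coeff_top)
  moreover have "coeff3 G (\<alpha> k + e * \<beta> k + k - n) ((if b = 0 then \<beta> else (\<lambda>k. 0)) k) k \<noteq> 0"
    if k: "k \<in> D" for k
  proof -
    have "coeff3 F i' j' k \<noteq> 0 \<Longrightarrow> \<alpha> k \<le> i' \<and> \<beta> k \<le> j'" for i' j'
      using monomial_levelsD(1) [OF F, of i' j' k] monomial_levelsD(2) [OF F, of k] k by auto
    then have *: "coeff3 G (\<alpha> k + e * \<beta> k + k - n) q k =
        coeff3 F (\<alpha> k) (\<beta> k) k * shift_coeff b (\<beta> k) q" if "q = \<beta> k \<or> b \<noteq> 0" for q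
      using that ge [OF k] by (intro single) auto
    show ?thesis
      using * [of "\<beta> k"] * [of 0] monomial_levelsD(4) [OF F k]
      by (cases "b = 0") (simp_all add: shift_coeff_top shift_coeff_bottom)
  qed
  moreover have "p = 0 \<and> q = 0 \<and> r = n \<or>
      r \<in> D \<and> \<alpha> r + e * \<beta> r + r - n \<le> p \<and> (if b = 0 then \<beta> else (\<lambda>k. 0)) r \<le> q"
    if "coeff3 G p q r \<noteq> 0" for p q r
  proof -
    from that obtain i j k where *: "coeff3 F i j k \<noteq> 0" "p + n = i + e * j + k"
      "shift_coeff b j q \<noteq> 0" "shift_coeff (0::'k) k r \<noteq> 0"
      unfolding G' by (rule X_chart_nonzeroE)
    have "k = r" "b = 0 \<longrightarrow> q = j" "q \<le> j"
      using *(3,4) shift_coeff_nonzeroD [OF *(3)] by (auto simp: shift_coeff_0 split: if_splits)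
    from monomial_levelsD(1) [OF F *(1)] show ?thesis
    proof (elim disjE conjE)
      assume "k \<in> D" "\<alpha> k \<le> i" "\<beta> k \<le> j"
      with e have "\<alpha> k + e * \<beta> k \<le> i + e * j" by auto
      with * \<open>k = r\<close> \<open>b = 0 \<longrightarrow> q = j\<close> \<open>k \<in> D\<close> \<open>\<beta> k \<le> j\<close> show ?thesis by auto
    qed (use *(2) \<open>k = r\<close> \<open>q \<le> j\<close> in auto)
  qed
  moreover have "D \<noteq> {}" "D \<subseteq> {k. k + 2 \<le> n}"
    using F by (simp_all add: monomial_levels_def)
  ultimately show ?thesis unfolding monomial_levels_def by simp
qed

lemma X_chart_divisible:
  fixes F :: "'k::field ser3"
  assumes "\<And>i j k. coeff3 F i j k \<noteq> 0 \<Longrightarrow> n \<le> i + e * j + k"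
  obtains G where "varX ^ n * G = X_chart e b c F"
proof
  let ?G = "Abs_fps (\<lambda>r. fps_shift n (fps_nth (X_chart e b c F) r))"
  have "coeff3 (X_chart e b c F) p q r = 0" if "p < n" for p q r
  proof (rule ccontr)
    assume "coeff3 (X_chart e b c F) p q r \<noteq> 0"
    then obtain i j k where "coeff3 F i j k \<noteq> 0" "p = i + e * j + k" by (rule X_chart_nonzeroE)
    with assms [of i j k] that show False by simp
  qed
  then show "varX ^ n * ?G = X_chart e b c F"
    by (intro coeff3_eqI)
       (auto simp: coeff3_varX_power_mult, simp add: coeff3_def coeff2_def)
qed

text \<open>
  On the line \<open>Y = 0\<close> the initial form is a monic polynomial of degree \<open>n\<close> in the \<open>Z\<close>-coordinate,
  which has a root as \<open>K\<close> is algebraically closed. This direction is legitimate for quadratic and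
  monoidal transformations alike, so that the algorithm never gets stuck.
\<close>

lemma tangent_cone_direction:
  fixes F :: "'k::alg_closed_field ser3"
  assumes "monomial_levels n D \<alpha> \<beta> F" "\<not> order3 F < enat n" "1 < n"
  obtains c where "tangent_cone_point F 1 0 c"
proof -
  let ?f = "\<lambda>k. coeff3 F (n - k) 0 k"
  have "?f n \<noteq> 0" using assms(1) by (simp add: monomial_levels_def)
  then obtain c where c: "(\<Sum>k\<le>n. ?f k * c ^ k) = 0"
    using alg_closed [of n ?f] \<open>1 < n\<close> by auto
  have "(\<Sum>k\<le>n. ?f k * c ^ k) =
      (\<Sum>(i, j, k)\<in>(\<lambda>k. (n - k, 0, k)) ` {..n}. coeff3 F i j k * 1 ^ i * 0 ^ j * c ^ k)"
    by (subst sum.reindex) (auto simp: inj_on_def)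
  also have "\<dots> = initial_form_at F 1 0 c"
    unfolding initial_form_at_def order3_eq [OF assms(1,2)]
  proof (rule sum.mono_neutral_left)
    show "finite {(i, j, k). enat (i + j + k) = enat n}"
      by (rule finite_subset [OF _ finite_total_degree_le [of n]]) auto
  qed (auto simp: image_iff)
  finally show thesis using c that by (simp add: tangent_cone_point_def)
qed

section \<open>Progress and termination of the algorithm\<close>

lemma quadratic_transform_chart:
  assumes "quadratic_transform n F G"
  obtains (X) b c where "varX ^ n * G = X_chart 1 b c F"
    | (Y) b c where "varX ^ n * swapXY G = X_chart 1 b c (swapXY F)"
proof -
  from assms obtain a b c where
    "varX ^ n * G = subst3 F varX (varX * (varY + const3 (b / a))) (varX * (varZ + const3 (c / a))) \<or>
     varY ^ n * G = subst3 F (varY * (varX + const3 (a / b))) varY (varY * (varZ + const3 (c / b)))"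
    unfolding quadratic_transform_def by blast
  then show thesis
  proof
    assume "varX ^ n * G =
      subst3 F varX (varX * (varY + const3 (b / a))) (varX * (varZ + const3 (c / a)))"
    then have "varX ^ n * G = X_chart 1 (b / a) (c / a) F" by (simp add: X_chart_def)
    then show thesis by (rule X)
  next
    assume "varY ^ n * G =
      subst3 F (varY * (varX + const3 (a / b))) varY (varY * (varZ + const3 (c / b)))"
    then have "swapXY (varY ^ n * G) =
      swapXY (subst3 F (varY * (varX + const3 (a / b))) varY (varY * (varZ + const3 (c / b))))"
      by (rule arg_cong)
    then have "varX ^ n * swapXY G = X_chart 1 (a / b) (c / b) (swapXY F)"
      by (simp add: X_chart_def swapXY_subst3)
    then show thesis by (rule Y)
  qed
qed

text \<open>
  A quadratic transformation is made only if \<open>(Z,Y)\<close> is not permissible, that is, if some level has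
  \<open>\<beta> k < n - k\<close>. As these are integers, \<open>\<beta> k / (n - k) \<le> 1 - 1 / (n - k) \<le> 1 - 1 / n\<close>, which is the
  margin required by the shear.
\<close>

lemma X_chart_progress:
  fixes F G :: "'k::field_char_0 ser3"
  assumes F: "monomial_levels n D \<alpha> \<beta> F" and n: "1 < n"
    and F_ge: "\<not> order3 F < enat n" and G_ge: "\<not> order3 G < enat n"
    and G: "varX ^ n * G = X_chart e b c F"
    and e: "e = 0 \<and> b = 0 \<and> (\<forall>k\<in>D. n \<le> \<alpha> k + k) \<or> e = 1 \<and> (\<exists>k\<in>D. \<beta> k + k < n)"
  obtains \<alpha>' \<beta>' where "monomial_levels n D \<alpha>' \<beta>' G"
    "potential D (scaled n \<alpha>') (scaled n \<beta>') \<le> potential D (scaled n \<alpha>) (scaled n \<beta>) - 1 / n"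
proof -
  define \<alpha>' where "\<alpha>' = (\<lambda>k. \<alpha> k + e * \<beta> k + k - n)"
  define \<beta>' where "\<beta>' = (if b = 0 then \<beta> else (\<lambda>k. 0))"
  have "e = 1 \<or> e = 0 \<and> b = 0" using e by blast
  moreover from this have "c = 0" using X_chart_drop [OF F n _ G] G_ge by blast
  moreover have ge: "n \<le> \<alpha> k + e * \<beta> k + k" if "k \<in> D" for k
    using e levels_sum_ge [OF F F_ge that] that by auto
  ultimately have "monomial_levels n D \<alpha>' \<beta>' G"
    unfolding \<alpha>'_def \<beta>'_def using X_chart_levels [OF F _ _ G [unfolded \<open>c = 0\<close>]] by blast
  moreover have lt: "k < n" if "k \<in> D" for k
    using monomial_levelsD(2) [OF F that] by simp
  have \<alpha>': "scaled n \<alpha>' k = scaled n \<alpha> k + e * scaled n \<beta> k - 1" if "k \<in> D" for k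
  proof -
    have "real (\<alpha>' k) = real (\<alpha> k) + e * real (\<beta> k) - real (n - k)"
      using ge [OF that] lt [OF that] by (simp add: \<alpha>'_def of_nat_diff)
    moreover have "real (n - k) \<noteq> 0" using lt [OF that] by simp
    ultimately show ?thesis
      unfolding scaled_def by (simp only: diff_divide_distrib add_divide_distrib
          times_divide_eq_right divide_self_if if_False)
  qed
  note D = finite_levels [OF F] monomial_levelsD(5) [OF F]
  have "potential D (scaled n \<alpha>') (scaled n \<beta>') \<le> potential D (scaled n \<alpha>) (scaled n \<beta>) - 1 / n"
    using e
  proof
    assume "e = 0 \<and> b = 0 \<and> (\<forall>k\<in>D. n \<le> \<alpha> k + k)"
    then have "potential D (scaled n \<alpha>') (scaled n \<beta>') \<le> potential D (scaled n \<alpha>) (scaled n \<beta>) - 1"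
      using \<alpha>' by (intro potential_shift [OF D]) (simp_all add: \<beta>'_def)
    also have "\<dots> \<le> potential D (scaled n \<alpha>) (scaled n \<beta>) - 1 / n" using n by simp
    finally show ?thesis .
  next
    assume e1: "e = 1 \<and> (\<exists>k\<in>D. \<beta> k + k < n)"
    then obtain k where k: "k \<in> D" "\<beta> k + k < n" by blast
    have "scaled n \<beta> k \<le> 1 - 1 / real (n - k)"
    proof -
      have "real (\<beta> k) + 1 \<le> real (n - k)" using k(2) by linarith
      then have "(real (\<beta> k) + 1) / real (n - k) \<le> 1"
        using lt [OF k(1)] by (simp add: divide_le_eq_1 of_nat_diff)
      then show ?thesis by (simp add: scaled_def add_divide_distrib)
    qed
    also have "\<dots> \<le> 1 - 1 / n" using lt [OF k(1)] by (simp add: frac_le)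
    finally have "\<exists>k\<in>D. scaled n \<beta> k \<le> 1 - 1 / n" using k(1) by blast
    moreover have "(\<forall>k\<in>D. scaled n \<beta>' k = scaled n \<beta> k) \<or> (\<forall>k\<in>D. scaled n \<beta>' k = 0)"
      by (simp add: \<beta>'_def scaled_def)
    ultimately show ?thesis
      using \<alpha>' e1 by (intro potential_shear [OF D]) (simp_all add: scaled_def)
  qed
  ultimately show thesis by (rule that)
qed

text \<open>
  Both charts are covered: the potential is symmetric in the two coordinates, so a step in a
  \<open>Y\<close>-chart is a step in an \<open>X\<close>-chart for the equation with \<open>X\<close> and \<open>Y\<close> exchanged.
\<close>

lemma algorithm_step_progress:
  fixes F G :: "'k::field_char_0 ser3"
  assumes F: "monomial_levels n D \<alpha> \<beta> F" and n: "1 < n"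
    and F_ge: "\<not> order3 F < enat n" and G_ge: "\<not> order3 G < enat n"
    and step: "algorithm_step n F G"
  obtains \<alpha>' \<beta>' where "monomial_levels n D \<alpha>' \<beta>' G"
    "potential D (scaled n \<alpha>') (scaled n \<beta>') \<le> potential D (scaled n \<alpha>) (scaled n \<beta>) - 1 / n"
proof -
  note F' = monomial_levels_swapXY [OF F]
  have F'_ge: "\<not> order3 (swapXY F) < enat n" and G'_ge: "\<not> order3 (swapXY G) < enat n"
    using F_ge G_ge by simp_all
  note result = that
  have swap: thesis
    if levels: "monomial_levels n D \<alpha>' \<beta>' (swapXY G)"
      and less: "potential D (scaled n \<alpha>') (scaled n \<beta>')
        \<le> potential D (scaled n \<beta>) (scaled n \<alpha>) - 1 / n" for \<alpha>' \<beta>'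
  proof (rule result [of \<beta>' \<alpha>'])
    show "monomial_levels n D \<beta>' \<alpha>' G" using monomial_levels_swapXY [OF levels] by simp
    show "potential D (scaled n \<beta>') (scaled n \<alpha>')
        \<le> potential D (scaled n \<alpha>) (scaled n \<beta>) - 1 / n"
      using less by (simp only: potential_commute [of D "scaled n \<beta>"]
          potential_commute [of D "scaled n \<beta>'"])
  qed
  have perm_ZX: "permissible_curve n F varZ varX \<longleftrightarrow> (\<forall>k\<in>D. n \<le> \<alpha> k + k)"
    by (simp add: permissible_ZX_iff ZX_order_ge_levels [OF F])
  have perm_ZY: "permissible_curve n F varZ varY \<longleftrightarrow> (\<forall>k\<in>D. n \<le> \<beta> k + k)"
    by (simp add: permissible_ZY_iff ZX_order_ge_levels [OF F'])
  consider (ZX) "\<forall>k\<in>D. n \<le> \<alpha> k + k" "monoidal_transform_ZX n F G"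
    | (ZY) "\<forall>k\<in>D. n \<le> \<beta> k + k" "monoidal_transform_ZY n F G"
    | (quad) "\<exists>k\<in>D. \<alpha> k + k < n" "\<exists>k\<in>D. \<beta> k + k < n" "quadratic_transform n F G"
    using step unfolding algorithm_step_def perm_ZX perm_ZY by (auto simp: not_le split: if_splits)
  then show thesis
  proof cases
    case ZX
    then obtain c where "varX ^ n * G = X_chart 0 0 c F"
      by (auto simp: monoidal_transform_ZX_def X_chart_def const3_def)
    then show thesis using X_chart_progress [OF F n F_ge G_ge] ZX(1) that by blast
  next
    case ZY
    then obtain c where "varX ^ n * swapXY G = X_chart 0 0 c (swapXY F)"
      by (auto simp: monoidal_transform_ZY_iff monoidal_transform_ZX_def X_chart_def const3_def)
    then show thesis using X_chart_progress [OF F' n F'_ge G'_ge] ZY(1) swap by blast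
  next
    case quad
    from quad(3) show thesis
    proof (cases rule: quadratic_transform_chart)
      case X
      then show thesis using X_chart_progress [OF F n F_ge G_ge] quad(2) that by blast
    next
      case Y
      then show thesis using X_chart_progress [OF F' n F'_ge G'_ge] quad(1) swap by blast
    qed
  qed
qed

lemma monoidal_transform_ZX_exists:
  fixes F :: "'k::alg_closed_field ser3"
  assumes "monomial_levels n D \<alpha> \<beta> F" "\<not> order3 F < enat n" "1 < n" "ZX_order_ge n F"
  shows "\<exists>G. monoidal_transform_ZX n F G"
proof -
  obtain c where c: "tangent_cone_point F 1 0 c"
    using tangent_cone_direction [OF assms(1-3)] .
  obtain G where "varX ^ n * G = X_chart 0 0 c F"
    by (rule X_chart_divisible [of F n 0 0 c]) (use assms(4) in \<open>force simp: ZX_order_ge_def\<close>)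
  then have "1 \<noteq> (0::'k) \<and> tangent_cone_point F 1 0 c \<and>
      varX ^ n * G = subst3 F varX varY (varX * (varZ + const3 (c / 1)))"
    using c by (simp add: X_chart_def const3_def)
  then show ?thesis unfolding monoidal_transform_ZX_def by blast
qed

lemma quadratic_transform_exists:
  fixes F :: "'k::alg_closed_field ser3"
  assumes "monomial_levels n D \<alpha> \<beta> F" "\<not> order3 F < enat n" "1 < n"
  shows "\<exists>G. quadratic_transform n F G"
proof -
  obtain c where c: "tangent_cone_point F 1 0 c"
    using tangent_cone_direction [OF assms] .
  obtain G where "varX ^ n * G = X_chart 1 0 c F"
    by (rule X_chart_divisible [of F n 1 0 c]) (use assms(2) in \<open>force simp: order3_less_iff\<close>)
  then have "tangent_cone_point F 1 0 c \<and> 1 \<noteq> (0::'k) \<and> varX ^ n * G =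
      subst3 F varX (varX * (varY + const3 (0 / 1))) (varX * (varZ + const3 (c / 1)))"
    using c by (simp add: X_chart_def)
  then show ?thesis unfolding quadratic_transform_def by blast
qed

lemma algorithm_step_exists:
  fixes F :: "'k::alg_closed_field ser3"
  assumes "monomial_levels n D \<alpha> \<beta> F" "\<not> order3 F < enat n" "1 < n"
  shows "\<exists>G. algorithm_step n F G"
proof -
  have "\<exists>G. monoidal_transform_ZY n F G" if "ZX_order_ge n (swapXY F)"
    using monoidal_transform_ZX_exists [OF monomial_levels_swapXY [OF assms(1)] _ assms(3) that]
      assms(2) monoidal_transform_ZY_iff by (metis order3_swapXY swapXY_swapXY)
  then show ?thesis
    using monoidal_transform_ZX_exists [OF assms] quadratic_transform_exists [OF assms]
    by (auto simp: algorithm_step_def permissible_ZX_iff permissible_ZY_iff)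
qed

lemma levels_potential_ge_1:
  assumes F: "monomial_levels n D \<alpha> \<beta> F" and ge: "\<not> order3 F < enat n"
  shows "1 \<le> potential D (scaled n \<alpha>) (scaled n \<beta>)"
proof (rule potential_ge_1)
  fix k assume k: "k \<in> D"
  have "0 < real (n - k)" "real (n - k) \<le> real (\<alpha> k) + real (\<beta> k)"
    using levels_sum_ge [OF F ge k] monomial_levelsD(2) [OF F k] by linarith+
  then have "1 \<le> (real (\<alpha> k) + real (\<beta> k)) / real (n - k)"
    by (simp only: le_divide_eq_1_pos)
  then show "1 \<le> scaled n \<alpha> k + scaled n \<beta> k"
    by (simp only: scaled_def add_divide_distrib)
qed (rule finite_levels [OF F], rule monomial_levelsD(5) [OF F])

text \<open>
  The potential cannot fall below 1 while the multiplicity is \<open>n\<close>, and each step that preserves the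
  multiplicity lowers it by at least \<open>1 / n\<close>.
\<close>

lemma drops_within_potential:
  fixes F :: "'k::{alg_closed_field, field_char_0} ser3"
  assumes "monomial_levels n D \<alpha> \<beta> F" "1 < n"
    and "n * (potential D (scaled n \<alpha>) (scaled n \<beta>) - 1) < m"
  shows "drops_within n m F"
  using assms(1,3)
proof (induction m arbitrary: F \<alpha> \<beta>)
  case 0
  show ?case
  proof (rule ccontr)
    assume "\<not> drops_within n 0 F"
    then have "1 \<le> potential D (scaled n \<alpha>) (scaled n \<beta>)"
      by (intro levels_potential_ge_1 [OF 0(1)]) simp
    then have "0 \<le> n * (potential D (scaled n \<alpha>) (scaled n \<beta>) - 1)" by simp
    with 0(2) show False by simp
  qed
next
  case (Suc m)
  show ?case
  proof (cases "order3 F < enat n")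
    case False
    have "drops_within n m G" if step: "algorithm_step n F G" for G
    proof (cases "order3 G < enat n")
      case True
      then show ?thesis by (cases m) simp_all
    next
      case G: False
      obtain \<alpha>' \<beta>' where G: "monomial_levels n D \<alpha>' \<beta>' G"
        and "potential D (scaled n \<alpha>') (scaled n \<beta>')
          \<le> potential D (scaled n \<alpha>) (scaled n \<beta>) - 1 / n"
        using algorithm_step_progress [OF Suc.prems(1) \<open>1 < n\<close> False G step] .
      then have "n * (potential D (scaled n \<alpha>') (scaled n \<beta>') - 1)
          \<le> n * (potential D (scaled n \<alpha>) (scaled n \<beta>) - 1 / n - 1)"
        by (intro mult_left_mono) auto
      also have "\<dots> = n * (potential D (scaled n \<alpha>) (scaled n \<beta>) - 1) - 1"
        using \<open>1 < n\<close> by (simp add: algebra_simps)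
      also have "\<dots> < m" using Suc.prems(2) by simp
      finally show ?thesis by (rule Suc.IH [OF G])
    qed
    then show ?thesis using algorithm_step_exists [OF Suc.prems(1) False \<open>1 < n\<close>] by simp
  qed simp
qed

section \<open>Vertices of Newton and Hironaka polygons\<close>

text \<open>
  Vertices of a convex hull of infinitely many points are found here as lexicographic minima of
  two linear functions that together separate points: the points lexicographically above a given
  point form a convex set, of which this point is extreme.
\<close>

lemma lexicographic_min_extreme:
  fixes f g :: "'a::real_vector \<Rightarrow> real"
  assumes "linear f" "linear g" and inj: "\<And>v w. f v = f w \<Longrightarrow> g v = g w \<Longrightarrow> v = w"
    and v: "v \<in> S" and min: "\<And>w. w \<in> S \<Longrightarrow> f v < f w \<or> f v = f w \<and> g v \<le> g w"
  shows "v extreme_point_of convex hull S"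
    and "w \<in> convex hull S \<Longrightarrow> f v < f w \<or> f v = f w \<and> g v \<le> g w"
proof -
  interpret f: linear f by fact
  interpret g: linear g by fact
  let ?H = "{w. f v < f w \<or> f v = f w \<and> g v \<le> g w}"
  have "convex ?H"
  proof (rule convexI)
    fix x y and s t :: real
    assume xy: "x \<in> ?H" "y \<in> ?H" and st: "0 \<le> s" "0 \<le> t" "s + t = 1"
    show "s *\<^sub>R x + t *\<^sub>R y \<in> ?H"
    \<comment> \<open>With positive weights, equality of the weighted values of \<open>f\<close> gives equality of its values.\<close>
    proof (cases "s = 0 \<or> t = 0")
      case True
      with st(3) have "s = 0 \<and> t = 1 \<or> s = 1 \<and> t = 0" by auto
      with xy show ?thesis by auto
    next
      case pos: False
      have le: "s * f v \<le> s * f x" "t * f v \<le> t * f y"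
        using xy st by (auto intro!: mult_left_mono)
      have sum: "f v = s * f v + t * f v" "g v = s * g v + t * g v"
        using st(3) by (metis distrib_right mult_1)+
      show ?thesis
      proof (cases "s * f v = s * f x \<and> t * f v = t * f y")
        case True
        with pos have eq: "f x = f v" "f y = f v" by auto
        then have "s * g v \<le> s * g x" "t * g v \<le> t * g y"
          using xy st by (auto intro!: mult_left_mono)
        moreover have "f (s *\<^sub>R x + t *\<^sub>R y) = f v"
          using sum(1) eq by (simp add: f.add f.scaleR)
        ultimately show ?thesis using sum(2) by (simp add: g.add g.scaleR)
      next
        case False
        with le have "s * f v + t * f v < s * f x + t * f y" by linarith
        with sum show ?thesis by (simp add: f.add f.scaleR)
      qed
    qed
  qed
  then have hull: "convex hull S \<subseteq> ?H"
    using min by (intro hull_minimal) auto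
  then show "w \<in> convex hull S \<Longrightarrow> f v < f w \<or> f v = f w \<and> g v \<le> g w" by blast
  have "v \<notin> open_segment a b" if "a \<in> convex hull S" "b \<in> convex hull S" for a b
  proof
    assume "v \<in> open_segment a b"
    then obtain t where t: "0 < t" "t < 1" "v = (1 - t) *\<^sub>R a + t *\<^sub>R b" and "a \<noteq> b"
      by (auto simp: in_segment)
    have split: "h v = (1 - t) * h a + t * h b" if "linear h" for h :: "'a \<Rightarrow> real"
      using t(3) that by (simp add: linear_add linear_scale)
    have ab: "a \<in> ?H" "b \<in> ?H" using that hull by auto
    have eq: "x = z \<and> y = z" if "z = (1 - t) * x + t * y" "z \<le> x" "z \<le> y" for x y z :: real
    proof -
      have "(1 - t) * (x - z) + t * (y - z) = 0" using that(1) by (simp add: algebra_simps)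
      moreover have "0 \<le> (1 - t) * (x - z)" "0 \<le> t * (y - z)" using t that by auto
      ultimately show ?thesis using t by (auto simp: add_nonneg_eq_0_iff)
    qed
    have f: "f a = f v \<and> f b = f v" using split [OF assms(1)] ab by (intro eq) auto
    moreover have "g a = g v \<and> g b = g v" using split [OF assms(2)] ab f by (intro eq) auto
    ultimately have "a = b" by (intro inj) auto
    with \<open>a \<noteq> b\<close> show False ..
  qed
  then show "v extreme_point_of convex hull S"
    using v by (auto simp: extreme_point_of_def hull_inc)
qed

lemma fst_snd_min_extreme:
  fixes v :: "real \<times> real"
  assumes "v \<in> S" "\<And>w. w \<in> S \<Longrightarrow> fst v < fst w \<or> fst v = fst w \<and> snd v \<le> snd w"
  shows "v extreme_point_of convex hull S"
    and "w \<in> convex hull S \<Longrightarrow> fst v < fst w \<or> fst v = fst w \<and> snd v \<le> snd w"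
proof -
  have lin: "linear (fst :: real \<times> real \<Rightarrow> real)" "linear (snd :: real \<times> real \<Rightarrow> real)"
    by (rule bounded_linear.linear, rule bounded_linear_fst bounded_linear_snd)+
  show "v extreme_point_of convex hull S"
    by (rule lexicographic_min_extreme(1) [OF lin _ assms]) (rule prod_eqI; assumption)
  show "w \<in> convex hull S \<Longrightarrow> fst v < fst w \<or> fst v = fst w \<and> snd v \<le> snd w"
    by (rule lexicographic_min_extreme(2) [OF lin _ assms]) (rule prod_eqI; assumption)
qed

lemma snd_fst_min_extreme:
  fixes v :: "real \<times> real"
  assumes "v \<in> S" "\<And>w. w \<in> S \<Longrightarrow> snd v < snd w \<or> snd v = snd w \<and> fst v \<le> fst w"
  shows "v extreme_point_of convex hull S"
proof -
  have lin: "linear (snd :: real \<times> real \<Rightarrow> real)" "linear (fst :: real \<times> real \<Rightarrow> real)"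
    by (rule bounded_linear.linear, rule bounded_linear_fst bounded_linear_snd)+
  show ?thesis
    by (rule lexicographic_min_extreme(1) [OF lin _ assms]) (rule prod_eqI; assumption)
qed

lemma lexicographic_least:
  fixes P :: "nat \<Rightarrow> nat \<Rightarrow> bool"
  assumes "P i0 j0"
  obtains a b where "P a b" "\<And>i j. P i j \<Longrightarrow> a < i \<or> a = i \<and> b \<le> j"
proof
  define a where "a = (LEAST i. \<exists>j. P i j)"
  define b where "b = (LEAST j. P a j)"
  have "\<exists>j. P a j" unfolding a_def using assms by (intro LeastI [of "\<lambda>i. \<exists>j. P i j" i0]) blast
  then show "P a b" unfolding b_def by (rule LeastI_ex)
  show "a < i \<or> a = i \<and> b \<le> j" if "P i j" for i j
  proof -
    have "a \<le> i" unfolding a_def using that by (intro Least_le) blast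
    moreover have "b \<le> j" if "P a j" unfolding b_def using that by (rule Least_le)
    ultimately show ?thesis using that by (auto simp: le_less)
  qed
qed

text \<open>
  The support of a series has two extreme corners, the lowest among the leftmost points and the
  leftmost among the lowest ones. Both are vertices of its Newton polyhedron; if there is only one
  vertex they coincide, and that common corner divides all monomials.
\<close>

lemma quadrant_level_corner:
  assumes quad: "is_quadrant (level_polyhedron k F)" and nz: "coeff3 F i0 j0 k \<noteq> 0"
  obtains a b where "coeff3 F a b k \<noteq> 0" "\<And>i j. coeff3 F i j k \<noteq> 0 \<Longrightarrow> a \<le> i \<and> b \<le> j"
proof -
  let ?S = "{(real (i + u), real (j + v)) | i j u v. coeff3 F i j k \<noteq> 0}"
  have mem: "(real i, real j) \<in> ?S" if "coeff3 F i j k \<noteq> 0" for i j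
    using that by (intro CollectI exI [of _ i] exI [of _ j] exI [of _ 0]) simp
  obtain a b where ab: "coeff3 F a b k \<noteq> 0"
    "\<And>i j. coeff3 F i j k \<noteq> 0 \<Longrightarrow> a < i \<or> a = i \<and> b \<le> j"
    using lexicographic_least [of "\<lambda>i j. coeff3 F i j k \<noteq> 0", OF nz] by metis
  obtain b' a' where ab': "coeff3 F a' b' k \<noteq> 0"
    "\<And>i j. coeff3 F i j k \<noteq> 0 \<Longrightarrow> b' < j \<or> b' = j \<and> a' \<le> i"
    using lexicographic_least [of "\<lambda>j i. coeff3 F i j k \<noteq> 0", OF nz] by metis
  have 1: "(real a, real b) extreme_point_of level_polyhedron k F"
    unfolding level_polyhedron_def
    using mem [OF ab(1)] by (rule fst_snd_min_extreme(1)) (use ab(2) in fastforce)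
  have 2: "(real a', real b') extreme_point_of level_polyhedron k F"
    unfolding level_polyhedron_def
    using mem [OF ab'(1)] by (rule snd_fst_min_extreme) (use ab'(2) in fastforce)
  have "level_polyhedron k F \<noteq> {}" using 1 by (auto simp: extreme_point_of_def)
  then have "(real a, real b) = (real a', real b')"
    using quad 1 2 unfolding is_quadrant_def by blast
  then have "a = a'" "b = b'" by simp_all
  show thesis
  proof (rule that [OF ab(1)])
    show "a \<le> i \<and> b \<le> j" if "coeff3 F i j k \<noteq> 0" for i j
      using ab(2) [OF that] ab'(2) [OF that] \<open>a = a'\<close> \<open>b = b'\<close> by auto
  qed
qed

text \<open>
  Rewriting with this equation is conditional on the level: it evaluates the levels \<open>n - 1\<close>, \<open>n\<close> and
  above, and leaves the lower ones as they are.
\<close>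

lemma WT_equation_coeff3:
  assumes "WT_equation n F" "1 < n"
  shows "coeff3 F i j k =
    (if k = n then if i = 0 \<and> j = 0 then 1 else 0 else if k + 2 \<le> n then coeff3 F i j k else 0)"
proof -
  have F: "F = varZ ^ n + (\<Sum>l = 0..n-2. fps_const (fps_nth F l) * varZ ^ l)"
    using assms(1) by (simp add: WT_equation_def)
  have "fps_nth F k = (if k = n then 1 else 0) + (\<Sum>l = 0..n-2. if k = l then fps_nth F l else 0)"
    by (subst F) (simp add: varZ_def fps_sum_nth if_distrib cong: if_cong)
  also have "\<dots> = (if k = n then 1 else 0) + (if k \<le> n - 2 then fps_nth F k else 0)"
    by (simp add: sum.delta')
  also have "\<dots> = (if k = n then 1 else if k + 2 \<le> n then fps_nth F k else 0)"
    using assms(2) by auto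
  finally show ?thesis
    by (auto simp: coeff3_def coeff2_def split: if_splits)
qed

lemma prepared_monomial_levels:
  assumes prep: "prepared n F" and n: "1 < n" and "F \<noteq> varZ ^ n"
  obtains D \<alpha> \<beta> where "monomial_levels n D \<alpha> \<beta> F"
proof -
  have WT: "WT_equation n F" using prep by (simp add: prepared_def)
  note coeff = WT_equation_coeff3 [OF WT n]
  define D where "D = {k. k + 2 \<le> n \<and> (\<exists>i j. coeff3 F i j k \<noteq> 0)}"
  have "\<forall>k\<in>D. \<exists>p. coeff3 F (fst p) (snd p) k \<noteq> 0 \<and>
      (\<forall>i j. coeff3 F i j k \<noteq> 0 \<longrightarrow> fst p \<le> i \<and> snd p \<le> j)"
  proof
    fix k assume "k \<in> D"
    then obtain i0 j0 where "k + 2 \<le> n" and nz: "coeff3 F i0 j0 k \<noteq> 0" by (auto simp: D_def)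
    then have "is_quadrant (level_polyhedron k F)" using prep by (simp add: prepared_def)
    then obtain a b where "coeff3 F a b k \<noteq> 0" "\<And>i j. coeff3 F i j k \<noteq> 0 \<Longrightarrow> a \<le> i \<and> b \<le> j"
      using quadrant_level_corner [OF _ nz] by metis
    then show "\<exists>p. coeff3 F (fst p) (snd p) k \<noteq> 0 \<and>
        (\<forall>i j. coeff3 F i j k \<noteq> 0 \<longrightarrow> fst p \<le> i \<and> snd p \<le> j)"
      by (intro exI [of _ "(a, b)"]) simp
  qed
  then obtain c where "\<forall>k\<in>D. coeff3 F (fst (c k)) (snd (c k)) k \<noteq> 0 \<and>
      (\<forall>i j. coeff3 F i j k \<noteq> 0 \<longrightarrow> fst (c k) \<le> i \<and> snd (c k) \<le> j)"
    by (rule bchoice [THEN exE])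
  then have c: "\<And>k. k \<in> D \<Longrightarrow> coeff3 F (fst (c k)) (snd (c k)) k \<noteq> 0"
    "\<And>k i j. k \<in> D \<Longrightarrow> coeff3 F i j k \<noteq> 0 \<Longrightarrow> fst (c k) \<le> i \<and> snd (c k) \<le> j"
    by blast+
  have "D \<noteq> {}"
  proof
    assume "D = {}"
    have "coeff3 F i j k = (if k = n \<and> i = 0 \<and> j = 0 then 1 else 0)" for i j k
    proof (cases "k + 2 \<le> n")
      case True
      with \<open>D = {}\<close> have "coeff3 F i j k = 0" unfolding D_def by blast
      with True show ?thesis by simp
    next
      case False
      then show ?thesis by (subst coeff) simp
    qed
    then have "F = varZ ^ n"
      by (intro coeff3_eqI) (simp add: varZ_def coeff3_def coeff2_def)
    with \<open>F \<noteq> varZ ^ n\<close> show False ..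
  qed
  moreover have "i = 0 \<and> j = 0 \<and> k = n \<or> k \<in> D \<and> fst (c k) \<le> i \<and> snd (c k) \<le> j"
    if nz: "coeff3 F i j k \<noteq> 0" for i j k
  proof (cases "k = n")
    case True
    then have "coeff3 F i j k = (if i = 0 \<and> j = 0 then 1 else 0)" by (subst coeff) simp
    with True nz show ?thesis by (simp split: if_splits)
  next
    case False
    have "k + 2 \<le> n"
    proof (rule ccontr)
      assume "\<not> k + 2 \<le> n"
      with False have "coeff3 F i j k = 0" by (subst coeff) simp
      with nz show False ..
    qed
    with nz have "k \<in> D" by (auto simp: D_def)
    with c(2) [OF this nz] show ?thesis by simp
  qed
  moreover have "D \<subseteq> {k. k + 2 \<le> n}" by (auto simp: D_def)
  moreover have "coeff3 F 0 0 n = 1" by (subst coeff) simp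
  ultimately have "monomial_levels n D (\<lambda>k. fst (c k)) (\<lambda>k. snd (c k)) F"
    using c(1) unfolding monomial_levels_def by simp
  then show thesis by (rule that)
qed

text \<open>
  The lexicographic corners are vertices of the Hironaka polygon, which bounds \<open>R\<^sub>1\<close> by the
  rightmost vertex. The leftmost vertex \<open>L\<close> lies in the hull and has minimal abscissa, so it is not
  below the corresponding corner.
\<close>

lemma potential_le_vertices:
  assumes F: "monomial_levels n D \<alpha> \<beta> F"
    and R: "rightmost_vertex (hironaka_polygon n F) R"
    and L: "leftmost_vertex (hironaka_polygon n F) L"
  shows "potential D (scaled n \<alpha>) (scaled n \<beta>) \<le> fst R + snd L"
proof -
  let ?S = "{(real i / real (n - k) + u, real j / real (n - k) + v) | i j k u v.
       k \<in> {0..n-2} \<and> coeff3 F i j k \<noteq> 0 \<and> u \<in> \<rat> \<and> 0 \<le> u \<and> v \<in> \<rat> \<and> 0 \<le> v}"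
  let ?p = "scaled n \<alpha>" and ?q = "scaled n \<beta>"
  note D = finite_levels [OF F] monomial_levelsD(5) [OF F]
  have corner_mem: "(?p k, ?q k) \<in> ?S" if "k \<in> D" for k
    using monomial_levelsD(2,4) [OF F that]
    by (intro CollectI exI [of _ "\<alpha> k"] exI [of _ "\<beta> k"] exI [of _ k] exI [of _ 0])
       (auto simp: scaled_def)
  have S_ge: "\<exists>k\<in>D. ?p k \<le> fst w \<and> ?q k \<le> snd w" if "w \<in> ?S" for w
  proof -
    from that obtain i j k u v where w: "w = (real i / real (n - k) + u, real j / real (n - k) + v)"
      and k: "k \<in> {0..n-2}" "coeff3 F i j k \<noteq> 0" and uv: "0 \<le> u" "0 \<le> v" by auto
    have "D \<noteq> {}" "\<And>k. k \<in> D \<Longrightarrow> k + 2 \<le> n" using F by (auto simp: monomial_levels_def)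
    with k(1) have "k \<noteq> n" by force
    with monomial_levelsD(1) [OF F k(2)] have "k \<in> D" "\<alpha> k \<le> i" "\<beta> k \<le> j" by simp_all
    moreover from this have "?p k \<le> real i / real (n - k)" "?q k \<le> real j / real (n - k)"
      by (simp_all add: scaled_def divide_right_mono)
    ultimately show ?thesis using w uv by (intro bexI [of _ k]) simp_all
  qed
  obtain k where k: "k \<in> D" "corner D ?p ?q = ?p k" "\<And>l. l \<in> D \<Longrightarrow> ?q k \<le> ?q l"
    "\<And>l. l \<in> D \<Longrightarrow> ?q l = ?q k \<Longrightarrow> ?p k \<le> ?p l"
    using corner_attained [OF D, of ?p ?q] by metis
  have "?q k < snd w \<or> ?q k = snd w \<and> ?p k \<le> fst w" if "w \<in> ?S" for w
    using S_ge [OF that] k(3,4) by force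
  then have "(?p k, ?q k) extreme_point_of hironaka_polygon n F"
    unfolding hironaka_polygon_def
    by (intro snd_fst_min_extreme [OF corner_mem [OF k(1)]]) auto
  then have "?p k \<le> fst R" using R by (auto simp: rightmost_vertex_def)
  obtain l where l: "l \<in> D" "corner D ?q ?p = ?q l" "\<And>k. k \<in> D \<Longrightarrow> ?p l \<le> ?p k"
    "\<And>k. k \<in> D \<Longrightarrow> ?p k = ?p l \<Longrightarrow> ?q l \<le> ?q k"
    using corner_attained [OF D, of ?q ?p] by metis
  have min: "?p l < fst w \<or> ?p l = fst w \<and> ?q l \<le> snd w" if "w \<in> ?S" for w
    using S_ge [OF that] l(3,4) by force
  then have "(?p l, ?q l) extreme_point_of hironaka_polygon n F"
    unfolding hironaka_polygon_def
    by (intro fst_snd_min_extreme(1) [OF corner_mem [OF l(1)]]) auto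
  then have "fst L \<le> ?p l" using L by (auto simp: leftmost_vertex_def)
  moreover have "?p l < fst L \<or> ?p l = fst L \<and> ?q l \<le> snd L"
    using fst_snd_min_extreme(2) [OF corner_mem [OF l(1)], of L] min L
    by (auto simp: leftmost_vertex_def extreme_point_of_def hironaka_polygon_def)
  ultimately have "?q l \<le> snd L" by linarith
  with \<open>?p k \<le> fst R\<close> k(2) l(2) show ?thesis by (simp add: potential_def)
qed

theorem theorem3:
  fixes F :: "'k::{alg_closed_field, field_char_0} ser3"
    and n :: nat
    and R L :: "real \<times> real"
  assumes "1 < n"
    and "order3 F = enat n"
    and "prepared n F"
    and "F \<noteq> varZ ^ n"
    and "rightmost_vertex (hironaka_polygon n F) R"
    and "leftmost_vertex (hironaka_polygon n F) L"
  shows "\<exists>m. real m \<le> real n * (fst R + snd L - 1) + 1 \<and> drops_within n m F"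
proof -
  obtain D \<alpha> \<beta> where F: "monomial_levels n D \<alpha> \<beta> F"
    using prepared_monomial_levels [OF assms(3,1,4)] .
  let ?b = "real n * (fst R + snd L - 1)"
  \<comment> \<open>At most \<open>\<lfloor>n(R\<^sub>1 + L\<^sub>2 - 1)\<rfloor>\<close> steps preserve the multiplicity; the following one lowers it.\<close>
  define m where "m = nat \<lfloor>?b\<rfloor> + 1"
  have "1 \<le> potential D (scaled n \<alpha>) (scaled n \<beta>)"
    using assms(2) by (intro levels_potential_ge_1 [OF F]) simp
  moreover have pot: "potential D (scaled n \<alpha>) (scaled n \<beta>) \<le> fst R + snd L"
    using potential_le_vertices [OF F assms(5,6)] .
  ultimately have "0 \<le> ?b" by simp
  then have "real m \<le> ?b + 1" "?b < real m"
    unfolding m_def by linarith+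
  moreover have "real n * (potential D (scaled n \<alpha>) (scaled n \<beta>) - 1) \<le> ?b"
    using pot by (intro mult_left_mono) simp_all
  ultimately have "drops_within n m F"
    using drops_within_potential [OF F \<open>1 < n\<close>, of m] by linarith
  with \<open>real m \<le> ?b + 1\<close> show ?thesis by blast
qed

end
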